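(* Let $L_i\subseteq\Sigma$ be a set of size $n_i$. Pre-processing $L_i$ for the randomized-partition intersection algorithms (Algorithms 3 and 4), i.e. building the data structure specified in the context, can be done in $\mathbf{O}(n_i\log n_i)$ time and $\mathbf{O}(n_i)$ space (measured in machine words).
   Context: Model and notation: $w$ is the number of bits of a machine word; word operations take $O(1)$ time; $\log=\log_2$; $[w]=\{1,\dots,w\}$. A subset $A\subseteq[w]$ is stored as a single machine word whose $y$-th bit is $1$ iff $y\in A$ (word representation). The universe is $\Sigma=\{0,1\}^w$; $g$ is a random permutation of $\Sigma$, $g_t(x)$ denotes the $t$ most significant bits of $g(x)$, and $h:\Sigma\to[w]$ is a random function from a universal hash family. Values of $g$ and $h$ are computable in $O(1)$ time. For $t\ge1$ and $z\in\{0,1\}^t$ put $L_i^z=\{x\in L_i: g_t(x)=z\}$, $h(L_i^z)=\{h(x):x\in L_i^z\}$, and $h^{-1}(y,L_i^z)=\{x\in L_i^z: h(x)=y\}$ for $y\in[w]$. Required data structure (multi-resolution structure): it must support simultaneously, for every $t=1,2,\dots,\lceil\log n_i\rceil$ and every $z\in\{0,1\}^t$, (i) retrieval of the word representation of $h(L_i^z)$; and (ii) for each $y\in[w]$, access to all elements of $h^{-1}(y,L_i^z)$, in the order of increasing $g(x)$, in time linear in $|h^{-1}(y,L_i^z)|$. These are the data accessed by the online algorithms: to intersect $L_1,\dots,L_k$ with $n_1\le\dots\le n_k$ (Algorithm 3 is the case $k=2$ and Algorithm 4 the general case), where $L_i$ is partitioned by $g_{t_i}$ with $t_1\le\dots\le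 t_k$, for each $z_k\in\{0,1\}^{t_k}$ one lets $z_i$ be the string of the highest $t_i$ bits of $z_k$, computes $H=\bigcap_i h(L_i^{z_i})$ by bitwise AND, and outputs $\bigcup_{y\in H}\bigcap_i h^{-1}(y,L_i^{z_i})$. In Algorithm 3 the parameter $t_i$ may depend on the sizes of both sets being intersected, so it is not known at pre-processing time. *)

theory Defs
  imports
    Complex_Main
    "HOL-Library.Landau_Symbols"
    "HOL-Library.FuncSet"
    "HOL-Combinatorics.Permutations"
begin

section \<open>Words, hash functions and the groups of the partition\<close>

text \<open>A \<open>w\<close>-bit word (an element of \<open>{0,1}^w\<close>) is the natural number below \<open>2 ^ w\<close> that it
  denotes in binary; likewise \<open>z \<in> {0,1}^t\<close> is a number below \<open>2 ^ t\<close>.\<close>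

definition Words :: "nat \<Rightarrow> nat set" where
  "Words w = {..<2 ^ w}"

text \<open>Carter-Wegman universality for a finite family from which \<open>h\<close> is drawn uniformly:
  two distinct keys collide with probability at most \<open>1 / w\<close>.\<close>

definition universal_family :: "nat \<Rightarrow> (nat \<Rightarrow> nat) set \<Rightarrow> bool" where
  "universal_family w F \<longleftrightarrow>
     finite F \<and> F \<noteq> {} \<and> F \<subseteq> Words w \<rightarrow> {1..w} \<and>
     (\<forall>x \<in> Words w. \<forall>x' \<in> Words w. x \<noteq> x' \<longrightarrow>
        real (card {h \<in> F. h x = h x'}) / real (card F) \<le> 1 / real w)"

definition top_bits :: "nat \<Rightarrow> nat \<Rightarrow> nat \<Rightarrow> nat" where
  "top_bits w t v = drop_bit (w - t) v"

text \<open>\<open>L\<^sup>z\<close> for \<open>z \<in> {0,1}^t\<close>\<close>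

definition group :: "nat \<Rightarrow> (nat \<Rightarrow> nat) \<Rightarrow> nat set \<Rightarrow> nat \<Rightarrow> nat \<Rightarrow> nat set" where
  "group w g L t z = {x \<in> L. top_bits w t (g x) = z}"

definition hash_preimage :: "(nat \<Rightarrow> nat) \<Rightarrow> nat \<Rightarrow> nat set \<Rightarrow> nat set" where
  "hash_preimage h y A = {x \<in> A. h x = y}"

text \<open>Elements of \<open>[w]\<close> are numbered from 1, bit positions of a number from 0.\<close>

definition is_word_rep :: "nat \<Rightarrow> nat set \<Rightarrow> nat \<Rightarrow> bool" where
  "is_word_rep w A v \<longleftrightarrow> v \<in> Words w \<and> (\<forall>y \<in> {1..w}. bit v (y - 1) \<longleftrightarrow> y \<in> A)"

section \<open>The word RAM\<close>

text \<open>Programs are finite pieces of syntax over finitely many word registers and finitely many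
  arrays of words. A single program has to work for all word lengths, hash functions and inputs.
  Numeric literals, like all other values, are truncated to \<open>w\<close> bits.\<close>

datatype unop = Compl | Ctz

datatype binop = Add | Sub | Mul | Div | Mod | And | Or | Xor | Shl | Shr | Eq | Less

datatype exp =
    Lit nat
  | Width
  | Reg nat
  | Unop unop exp
  | Binop binop exp exp
  | GVal exp
  | HVal exp

datatype com =
    Skip
  | Assign nat exp
  | Load nat nat exp
  | Store nat exp exp
  | Emit exp
  | Seq com com
  | Cond exp com com
  | While exp com

text \<open>The memory consists of \<open>narrays\<close> arrays of \<open>ncells\<close> words each. A constant number of
  arrays rather than a single one is used because a data structure of \<open>O(n)\<close> words for
  \<open>n \<le> 2 ^ w\<close> may have slightly more than \<open>2 ^ w\<close> cells, too many to be addressed by one word.\<close>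

record machine =
  wlen :: nat
  gfun :: "nat \<Rightarrow> nat"
  hfun :: "nat \<Rightarrow> nat"
  narrays :: nat
  ncells :: nat

record state =
  regs :: "nat \<Rightarrow> nat"
  arrs :: "nat \<Rightarrow> nat \<Rightarrow> nat"
  outp :: "nat list"

text \<open>\<open>Ctz\<close> counts trailing zeros, with value \<open>w\<close> at 0. The arguments of the operations below are
  words; \<open>Add\<close>, \<open>Sub\<close>, \<open>Mul\<close> are taken modulo \<open>2 ^ w\<close>, and \<open>a div 0 = 0\<close>, \<open>a mod 0 = a\<close>.\<close>

fun unop_val :: "nat \<Rightarrow> unop \<Rightarrow> nat \<Rightarrow> nat" where
  "unop_val w Compl a = 2 ^ w - 1 - a"
| "unop_val w Ctz a = (if a = 0 then w else (LEAST k. bit a k))"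

fun binop_val :: "nat \<Rightarrow> binop \<Rightarrow> nat \<Rightarrow> nat \<Rightarrow> nat" where
  "binop_val w Add a b = a + b"
| "binop_val w Sub a b = a + (2 ^ w - b)"
| "binop_val w Mul a b = a * b"
| "binop_val w Div a b = a div b"
| "binop_val w Mod a b = a mod b"
| "binop_val w And a b = Bit_Operations.and a b"
| "binop_val w Or a b = Bit_Operations.or a b"
| "binop_val w Xor a b = Bit_Operations.xor a b"
| "binop_val w Shl a b = push_bit b a"
| "binop_val w Shr a b = drop_bit b a"
| "binop_val w Eq a b = of_bool (a = b)"
| "binop_val w Less a b = of_bool (a < b)"

primrec exp_val :: "machine \<Rightarrow> exp \<Rightarrow> (nat \<Rightarrow> nat) \<Rightarrow> nat" where
  "exp_val M (Lit n) r = take_bit (wlen M) n"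
| "exp_val M Width r = take_bit (wlen M) (wlen M)"
| "exp_val M (Reg i) r = take_bit (wlen M) (r i)"
| "exp_val M (Unop f e) r = take_bit (wlen M) (unop_val (wlen M) f (exp_val M e r))"
| "exp_val M (Binop f e e') r =
    take_bit (wlen M) (binop_val (wlen M) f (exp_val M e r) (exp_val M e' r))"
| "exp_val M (GVal e) r = take_bit (wlen M) (gfun M (exp_val M e r))"
| "exp_val M (HVal e) r = take_bit (wlen M) (hfun M (exp_val M e r))"

text \<open>\<open>exec M c s t s'\<close>: started in \<open>s\<close>, program \<open>c\<close> halts in \<open>s'\<close> after \<open>t\<close> steps and accesses
  no memory outside the \<open>narrays M\<close> arrays of \<open>ncells M\<close> words (such an access has no rule).
  A program contains finitely many expressions, each with a fixed number of word operations, so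
  charging one step per executed command and per evaluated test is unit cost per word operation
  up to a constant factor depending on the program only. \<open>Emit\<close> appends a word to a write-only
  output stream.\<close>

inductive exec :: "machine \<Rightarrow> com \<Rightarrow> state \<Rightarrow> nat \<Rightarrow> state \<Rightarrow> bool" for M :: machine where
  Skip: "exec M Skip s 1 s"
| Assign: "exec M (Assign i e) s 1 (s\<lparr>regs := (regs s)(i := exp_val M e (regs s))\<rparr>)"
| Load: "a < narrays M \<Longrightarrow> exp_val M e (regs s) < ncells M \<Longrightarrow>
    exec M (Load i a e) s 1 (s\<lparr>regs := (regs s)(i := arrs s a (exp_val M e (regs s)))\<rparr>)"
| Store: "a < narrays M \<Longrightarrow> exp_val M e (regs s) < ncells M \<Longrightarrow>
    exec M (Store a e e') s 1
      (s\<lparr>arrs := (arrs s)(a := (arrs s a)(exp_val M e (regs s) := exp_val M e' (regs s)))\<rparr>)"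
| Emit: "exec M (Emit e) s 1 (s\<lparr>outp := outp s @ [exp_val M e (regs s)]\<rparr>)"
| Seq: "exec M c s t s' \<Longrightarrow> exec M c' s' t' s'' \<Longrightarrow> exec M (Seq c c') s (t + t') s''"
| CondTrue: "exp_val M e (regs s) \<noteq> 0 \<Longrightarrow> exec M c s t s' \<Longrightarrow> exec M (Cond e c c') s (Suc t) s'"
| CondFalse: "exp_val M e (regs s) = 0 \<Longrightarrow> exec M c' s t s' \<Longrightarrow> exec M (Cond e c c') s (Suc t) s'"
| WhileTrue: "exp_val M e (regs s) \<noteq> 0 \<Longrightarrow> exec M c s t s' \<Longrightarrow> exec M (While e c) s' t' s'' \<Longrightarrow>
    exec M (While e c) s (Suc (t + t')) s''"
| WhileFalse: "exp_val M e (regs s) = 0 \<Longrightarrow> exec M (While e c) s 1 s"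

inductive_cases exec_elims:
  "exec M Skip s t s'" "exec M (Assign i e) s t s'" "exec M (Load i a e) s t s'"
  "exec M (Store a e e') s t s'" "exec M (Emit e) s t s'" "exec M (Seq c c') s t s'"
  "exec M (Cond e c c') s t s'"

inductive_cases exec_WhileE: "exec M (While e c) s t s'"

lemma exec_deterministic:
  "exec M c s t s' \<Longrightarrow> exec M c s u s'' \<Longrightarrow> u = t \<and> s'' = s'"
proof (induction arbitrary: u s'' rule: exec.induct)
  case (Seq c s t s1 c' t' s2)
  from Seq.prems obtain u1 u2 r where "exec M c s u1 r" "exec M c' r u2 s''" "u = u1 + u2"
    by (cases rule: exec_elims(6)) auto
  then show ?case using Seq.IH by blast
next
  case (CondTrue e s c t s1 c')
  from CondTrue.prems CondTrue.hyps(1) obtain u1 where "exec M c s u1 s''" "u = Suc u1"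
    by (cases rule: exec_elims(7)) auto
  then show ?case using CondTrue.IH by blast
next
  case (CondFalse e s c' t s1 c)
  from CondFalse.prems CondFalse.hyps(1) obtain u1 where "exec M c' s u1 s''" "u = Suc u1"
    by (cases rule: exec_elims(7)) auto
  then show ?case using CondFalse.IH by blast
next
  case (WhileTrue e s c t s1 t' s2)
  from WhileTrue.prems WhileTrue.hyps(1) obtain u1 u2 r
    where "exec M c s u1 r" "exec M (While e c) r u2 s''" "u = Suc (u1 + u2)"
    by (cases rule: exec_WhileE) auto
  then show ?case using WhileTrue.IH by blast
next
  case (WhileFalse e s c)
  from WhileFalse.prems WhileFalse.hyps show ?case
    by (cases rule: exec_WhileE) auto
qed (erule exec_elims; simp)+

section \<open>Pre-processing and the multi-resolution structure\<close>

text \<open>The input elements are in array 0, in arbitrary order; all other memory is 0. Register 0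
  holds \<open>n - 1\<close>, since \<open>n = 2 ^ w\<close> does not fit into a word.\<close>

definition input_state :: "nat list \<Rightarrow> state" where
  "input_state xs =
     \<lparr>regs = (\<lambda>_. 0)(0 := length xs - 1),
      arrs = (\<lambda>_ _. 0)(0 := (\<lambda>i. if i < length xs then xs ! i else 0)),
      outp = []\<rparr>"

text \<open>A query sees the memory left by the pre-processing, but none of its registers.\<close>

definition query_state :: "(nat \<Rightarrow> nat \<Rightarrow> nat) \<Rightarrow> nat \<Rightarrow> nat \<Rightarrow> nat \<Rightarrow> state" where
  "query_state A t z y = \<lparr>regs = (\<lambda>_. 0)(0 := t, 1 := z, 2 := y), arrs = A, outp = []\<rparr>"

text \<open>The query returns the word list \<open>ys\<close> within \<open>b\<close> steps and leaves the memory unchanged (so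
  that any number of queries can follow one another).\<close>

definition answers ::
    "machine \<Rightarrow> com \<Rightarrow> (nat \<Rightarrow> nat \<Rightarrow> nat) \<Rightarrow> nat \<Rightarrow> nat \<Rightarrow> nat \<Rightarrow> nat list \<Rightarrow> nat \<Rightarrow> bool" where
  "answers M q A t z y ys b \<longleftrightarrow>
     (\<exists>k s. exec M q (query_state A t z y) k s \<and> k \<le> b \<and> outp s = ys \<and> arrs s = A)"

text \<open>The memory contents \<open>A\<close> store the multi-resolution structure of \<open>L\<close>: program \<open>q1\<close>
  retrieves the word representation of \<open>h(L\<^sup>z)\<close> in constant time, and \<open>q2\<close> lists
  \<open>h\<^sup>-\<^sup>1(y, L\<^sup>z)\<close> by increasing \<open>g\<close> in linear time. The summand 1 in the time bound of \<open>q2\<close> pays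
  for the detection of an empty preimage.\<close>

definition multi_resolution ::
    "machine \<Rightarrow> com \<Rightarrow> com \<Rightarrow> nat \<Rightarrow> nat set \<Rightarrow> (nat \<Rightarrow> nat \<Rightarrow> nat) \<Rightarrow> bool" where
  "multi_resolution M q1 q2 C L A \<longleftrightarrow>
     (\<forall>t \<in> {1..nat \<lceil>log 2 (real (card L))\<rceil>}. \<forall>z \<in> {..<2 ^ t}.
        (\<exists>v. is_word_rep (wlen M) (hfun M ` group (wlen M) (gfun M) L t z) v \<and>
             answers M q1 A t z 0 [v] C) \<and>
        (\<forall>y \<in> {1..wlen M}.
           let B = hash_preimage (hfun M) y (group (wlen M) (gfun M) L t z) in
           \<exists>ys. set ys = B \<and> sorted_wrt (<) (map (gfun M) ys) \<and>
                answers M q2 A t z y ys (C * (1 + card B))))"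

end

theory Submission
  imports Defs
begin

text \<open>With the elements sorted by \<open>g\<close> (merge sort), every group is an interval, and there are fewer than
  \<open>4 n\<close> groups of all resolutions together. Each of them stores its left end and the word
  representation of its hash values, which takes \<open>O(n)\<close> time per resolution. An element is linked to
  the next one with the same hash value, so that a preimage can be listed once its first element is
  known.

  The difficulty is to find this element in constant time with \<open>O(n)\<close> words, since the groups of all
  resolutions may have \<open>n log n\<close> different hash values in total. For the position \<open>p\<close>, we save the
  first position \<open>\<ge> p\<close> that has the hash value \<open>p mod w + 1\<close>, and a \<open>w\<close>-bit mask of those among the
  \<open>w\<close> positions from \<open>p\<close> on that have the same hash value as \<open>p\<close>. From the left end \<open>l\<close> of a group one
  goes back by less than \<open>w\<close> positions to the last place where the hash value \<open>y\<close> was saved, and the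
  mask found there leads to the last occurrence of \<open>y\<close> before \<open>l\<close>. For \<open>l < y - 1\<close> there is no such
  place; then the first occurrence of \<open>y\<close> in the whole array is looked up. For this, an entry for
  each of the \<open>w\<close> hash values is needed even if \<open>n\<close> is much smaller than \<open>w\<close>, but as these entries have
  \<open>\<lceil>log n\<rceil>\<close> bits each, they fit into \<open>O(log n)\<close> words.\<close>

section \<open>Verification of word RAM programs\<close>

text \<open>The window length \<open>w\<close> serves both tables at once: \<open>w\<close>
  consecutive positions meet every residue modulo \<open>w\<close>, so an answer saved for any given
  \<open>y\<close> lies in the window, and one word has exactly the bits needed to record the
  occurrences of a single hash value in it.

  Searching never has to decide whether \<open>y\<close> occurs in the group. That is bit
  \<open>y - 1\<close> of the stored word and is tested beforehand. As a group is an interval of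
  positions, the first occurrence of \<open>y\<close> from its left end on then automatically
  belongs to the group, and the walk along the links may stop at the first element with another
  prefix.

  On the machine the obstacle is that \<open>n\<close> may be as large as \<open>2 ^ w\<close>:
  counters, ends of runs and differences of positions can wrap around, and each such value has to be
  shown harmless.

  The time bound comes from \<open>T\<close> rounds of linear cost for sorting and \<open>T\<close>
  more for the groups; linking is a single linear round. Loops are confined to \<open>sweep\<close>,
  \<open>levels\<close> and the walk along the links, so all other code has a cost fixed by its
  syntax.\<close>

primrec wp :: "machine \<Rightarrow> com \<Rightarrow> (state \<Rightarrow> bool) \<Rightarrow> state \<Rightarrow> bool" where
  "wp M Skip Q s \<longleftrightarrow> Q s"
| "wp M (Assign i e) Q s \<longleftrightarrow> Q (s\<lparr>regs := (regs s)(i := exp_val M e (regs s))\<rparr>)"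
| "wp M (Load i a e) Q s \<longleftrightarrow> a < narrays M \<and> exp_val M e (regs s) < ncells M \<and>
     Q (s\<lparr>regs := (regs s)(i := arrs s a (exp_val M e (regs s)))\<rparr>)"
| "wp M (Store a e e') Q s \<longleftrightarrow> a < narrays M \<and> exp_val M e (regs s) < ncells M \<and>
     Q (s\<lparr>arrs := (arrs s)(a := (arrs s a)(exp_val M e (regs s) := exp_val M e' (regs s)))\<rparr>)"
| "wp M (Emit e) Q s \<longleftrightarrow> Q (s\<lparr>outp := outp s @ [exp_val M e (regs s)]\<rparr>)"
| "wp M (Seq c c') Q s \<longleftrightarrow> wp M c (wp M c' Q) s"
| "wp M (Cond e c c') Q s \<longleftrightarrow>
     (if exp_val M e (regs s) \<noteq> 0 then wp M c Q s else wp M c' Q s)"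
| "wp M (While e c) Q s \<longleftrightarrow> False"

text \<open>The bound depends on the program only, so a conditional is charged for both branches.
  The value 0 at a loop does no harm: \<open>wp\<close> is false there, and \<open>runs_wp\<close>
  never has to justify it.\<close>

primrec cost :: "com \<Rightarrow> nat" where
  "cost Skip = 1"
| "cost (Assign i e) = 1"
| "cost (Load i a e) = 1"
| "cost (Store a e e') = 1"
| "cost (Emit e) = 1"
| "cost (Seq c c') = cost c + cost c'"
| "cost (Cond e c c') = Suc (cost c + cost c')"
| "cost (While e c) = 0"

definition runs :: "machine \<Rightarrow> com \<Rightarrow> state \<Rightarrow> nat \<Rightarrow> (state \<Rightarrow> bool) \<Rightarrow> bool" where
  "runs M c s b Q \<longleftrightarrow> (\<exists>t s'. exec M c s t s' \<and> t \<le> b \<and> Q s')"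

lemma runs_mono:
  "runs M c s b Q \<Longrightarrow> b \<le> b' \<Longrightarrow> (\<And>s'. Q s' \<Longrightarrow> Q' s') \<Longrightarrow> runs M c s b' Q'"
  unfolding runs_def by (meson order_trans)

lemma runs_Seq:
  "runs M c s b (\<lambda>s'. runs M c' s' b' Q) \<Longrightarrow> runs M (Seq c c') s (b + b') Q"
  unfolding runs_def by (meson exec.Seq add_mono)

lemma wp_mono: "wp M c Q s \<Longrightarrow> (\<And>s'. Q s' \<Longrightarrow> Q' s') \<Longrightarrow> wp M c Q' s"
proof (induction c arbitrary: Q Q' s)
  case (Seq c c')
  have "wp M c (wp M c' Q) s" using Seq.prems by simp
  then have "wp M c (wp M c' Q') s"
    by (rule Seq.IH(1)) (erule Seq.IH(2), erule Seq.prems(2))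
  then show ?case by simp
qed (auto split: if_splits)

lemma runs_wp: "wp M c Q s \<Longrightarrow> runs M c s (cost c) Q"
proof (induction c arbitrary: Q s)
  case (Seq c c')
  have "runs M c s (cost c) (\<lambda>s'. runs M c' s' (cost c') Q)"
    by (rule Seq.IH(1), rule wp_mono[of _ _ "wp M c' Q"]) (use Seq in auto)
  then show ?case by (simp add: runs_Seq)
next
  case (Cond e c c')
  show ?case
  proof (cases "exp_val M e (regs s) = 0")
    case True
    then have "runs M c' s (cost c') Q" using Cond by simp
    then show ?thesis
      unfolding runs_def using True by (fastforce intro: exec.CondFalse)
  next
    case False
    then have "runs M c s (cost c) Q" using Cond by simp
    then show ?thesis
      unfolding runs_def using False by (fastforce intro: exec.CondTrue)
  qed
qed (auto simp: runs_def intro!: exI intro: exec.intros)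

lemma runs_Cond:
  assumes "exp_val M e (regs s) \<noteq> 0 \<Longrightarrow> runs M c s b Q"
    and "exp_val M e (regs s) = 0 \<Longrightarrow> runs M c' s b Q"
  shows "runs M (Cond e c c') s (Suc b) Q"
  using assms unfolding runs_def
  by (metis (no_types, lifting) Suc_le_mono exec.CondFalse exec.CondTrue)

lemma runs_While_0: "exp_val M e (regs s) = 0 \<Longrightarrow> Q s \<Longrightarrow> runs M (While e c) s 1 Q"
  unfolding runs_def by (blast intro: exec.WhileFalse)

lemma runs_While_Suc:
  assumes "exp_val M e (regs s) \<noteq> 0" "runs M c s b (\<lambda>s'. runs M (While e c) s' b' Q)"
  shows "runs M (While e c) s (Suc (b + b')) Q"
  using assms unfolding runs_def by (meson exec.WhileTrue add_mono Suc_le_mono)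

section \<open>Symbolic execution of loop-free code\<close>

primrec block :: "com list \<Rightarrow> com" where
  "block [] = Skip"
| "block (c # cs) = Seq c (block cs)"

text \<open>The rules for symbolic execution expect the state in the form of an explicit record: with
  nested record updates the state would double in size at every step.\<close>

lemma wp_start: "wp M c Q \<lparr>regs = regs s, arrs = arrs s, outp = outp s\<rparr> \<Longrightarrow> wp M c Q s"
  by (cases s) simp

lemma wp_block_Assign:
  "exp_val M e r = v \<Longrightarrow> wp M (block cs) Q \<lparr>regs = r(i := v), arrs = A, outp = os\<rparr> \<Longrightarrow>
   wp M (block (Assign i e # cs)) Q \<lparr>regs = r, arrs = A, outp = os\<rparr>"
  by simp

lemma wp_block_Load:
  "exp_val M e r = v \<Longrightarrow> a < narrays M \<Longrightarrow> v < ncells M \<Longrightarrow> A a v = u \<Longrightarrow>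
   wp M (block cs) Q \<lparr>regs = r(i := u), arrs = A, outp = os\<rparr> \<Longrightarrow>
   wp M (block (Load i a e # cs)) Q \<lparr>regs = r, arrs = A, outp = os\<rparr>"
  by simp

lemma wp_block_Store:
  "exp_val M e r = v \<Longrightarrow> a < narrays M \<Longrightarrow> v < ncells M \<Longrightarrow> exp_val M e' r = u \<Longrightarrow>
   wp M (block cs) Q \<lparr>regs = r, arrs = A(a := (A a)(v := u)), outp = os\<rparr> \<Longrightarrow>
   wp M (block (Store a e e' # cs)) Q \<lparr>regs = r, arrs = A, outp = os\<rparr>"
  by simp

lemma wp_block_Emit:
  "exp_val M e r = v \<Longrightarrow> wp M (block cs) Q \<lparr>regs = r, arrs = A, outp = os @ [v]\<rparr> \<Longrightarrow>
   wp M (block (Emit e # cs)) Q \<lparr>regs = r, arrs = A, outp = os\<rparr>"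
  by simp

lemma wp_block_Cond:
  "exp_val M e (regs s) = v \<Longrightarrow> (v \<noteq> 0 \<Longrightarrow> wp M (block (c # cs)) Q s) \<Longrightarrow>
   (v = 0 \<Longrightarrow> wp M (block (c' # cs)) Q s) \<Longrightarrow> wp M (block (Cond e c c' # cs)) Q s"
  by simp

lemma wp_block_mid:
  "wp M c P s \<Longrightarrow> (\<And>s'. P s' \<Longrightarrow> wp M (block cs) Q s') \<Longrightarrow> wp M (block (c # cs)) Q s"
  by (simp add: wp_mono)

lemma wp_Cond:
  "exp_val M e (regs s) = v \<Longrightarrow> (v \<noteq> 0 \<Longrightarrow> wp M c Q s) \<Longrightarrow> (v = 0 \<Longrightarrow> wp M c' Q s) \<Longrightarrow>
   wp M (Cond e c c') Q s"
  by simp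

lemma wp_Skip: "Q s \<Longrightarrow> wp M Skip Q s"
  by simp

lemma wp_block_append: "wp M (block (cs @ cs')) Q = wp M (block cs) (wp M (block cs') Q)"
  by (induction cs) (simp_all add: ext)

lemma wp_block_block: "wp M (block (cs @ cs')) Q s \<Longrightarrow> wp M (block (block cs # cs')) Q s"
  by (simp add: wp_block_append)

lemma wp_block_Skip: "wp M (block cs) Q s \<Longrightarrow> wp M (block (Skip # cs)) Q s"
  by simp

lemma wp_block_Nil: "Q s \<Longrightarrow> wp M (block []) Q s"
  by simp

section \<open>Arithmetic of words truncated to \<open>w\<close> bits\<close>

lemma and_of_bool: "Bit_Operations.and (of_bool P) (of_bool Q) = (of_bool (P \<and> Q) :: nat)"
  by (cases P; cases Q) simp_all

lemma take_bit_of_bool_word: "w \<ge> 1 \<Longrightarrow> take_bit w (of_bool P) = (of_bool P :: nat)"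
  by (cases P) simp_all

text \<open>The machine subtracts by adding \<open>2 ^ w - b\<close>; for \<open>b \<le> a\<close>
  the surplus \<open>2 ^ w\<close> is what truncation removes. The second equation is for the
  reassociated form of the same sum.\<close>

lemma take_bit_sub:
  fixes a b w :: nat
  assumes "b \<le> a" "a < 2 ^ w"
  shows "take_bit w (a + (2 ^ w - b)) = a - b" "take_bit w (a + 2 ^ w - b) = a - b"
proof -
  have *: "a + (2 ^ w - b) = (a - b) + 2 ^ w" using assms by simp
  then have "take_bit w (a + (2 ^ w - b)) = (a - b) mod 2 ^ w"
    by (simp only: take_bit_eq_mod mod_add_self2)
  then show "take_bit w (a + (2 ^ w - b)) = a - b" using assms by simp
  then show "take_bit w (a + 2 ^ w - b) = a - b" using assms by simp
qed

text \<open>Since \<open>n\<close> itself need not fit into a word, a sweep over \<open>0, \<dots>, n - 1\<close> is controlled by a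
  flag computed before the counter is incremented; the last increment may wrap around.\<close>

definition sweep :: "com \<Rightarrow> com" where
  "sweep c = Seq (Assign 2 (Lit 0)) (Seq (Assign 3 (Lit 1))
     (While (Reg 3)
        (Seq c (Seq (Assign 3 (Binop Less (Reg 2) (Reg 0)))
                    (Assign 2 (Binop Add (Reg 2) (Lit 1)))))))"

text \<open>The assumption \<open>frame\<close> lets the loop overwrite its own registers 2 and 3.
  Each round adds 3 steps to the body (the test and two assignments); the final 3 are the two
  initial assignments and the failing test.\<close>

lemma runs_sweep:
  fixes M :: machine
  assumes w: "wlen M \<ge> 1" and N: "N < 2 ^ wlen M"
    and frame: "\<And>k s u v. J k s \<Longrightarrow> J k (s\<lparr>regs := (regs s)(2 := u, 3 := v)\<rparr>)"
    and body: "\<And>k s. k \<le> N \<Longrightarrow> J k s \<Longrightarrow> regs s 0 = N \<Longrightarrow> regs s 2 = k \<Longrightarrow>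
      runs M c s b (\<lambda>s'. J (Suc k) s' \<and> regs s' 0 = N \<and> regs s' 2 = k)"
    and J: "J 0 s" and s: "regs s 0 = N"
  shows "runs M (sweep c) s ((N + 1) * (b + 3) + 3) (\<lambda>s'. J (Suc N) s' \<and> regs s' 0 = N)"
proof -
  let ?inc = "Seq (Assign 3 (Binop Less (Reg 2) (Reg 0))) (Assign 2 (Binop Add (Reg 2) (Lit 1)))"
  let ?loop = "While (Reg 3) (Seq c ?inc)"
  have one: "take_bit (wlen M) (1 :: nat) = 1" using w by (simp add: take_bit_Suc_from_most)
  \<comment> \<open>Register 2 is only claimed to equal \<open>k\<close> while
    \<open>k \<le> N\<close>: for \<open>N + 1 = 2 ^ w\<close> the last increment yields 0, and the
    flag in register 3 is what ends the loop.\<close>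
  have loop: "runs M ?loop s (m * (b + 3) + 1) (\<lambda>s'. J (Suc N) s' \<and> regs s' 0 = N)"
    if "m = Suc N - k" "k \<le> Suc N" "J k s" "regs s 0 = N" "k \<le> N \<Longrightarrow> regs s 2 = k"
      "regs s 3 = of_bool (k \<le> N)" for m k s
    using that
  proof (induction m arbitrary: k s)
    case 0
    then have "k = Suc N" by simp
    then show ?case using 0 by (intro runs_mono[OF runs_While_0]) auto
  next
    case (Suc m)
    then have k: "k \<le> N" by simp
    have "runs M (Seq c ?inc) s (b + 2)
       (\<lambda>s'. runs M ?loop s' (m * (b + 3) + 1) (\<lambda>s'. J (Suc N) s' \<and> regs s' 0 = N))"
    proof (rule runs_Seq, rule runs_mono[OF body[of k s]])
      show "k \<le> N" "J k s" "regs s 0 = N" "regs s 2 = k" using Suc.prems k by auto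
    next
      fix s' assume s': "J (Suc k) s' \<and> regs s' 0 = N \<and> regs s' 2 = k"
      let ?s = "s'\<lparr>regs := (regs s')(2 := take_bit (wlen M) (Suc k), 3 := of_bool (k < N))\<rparr>"
      have "runs M ?inc s' (cost ?inc) (\<lambda>s''. s'' = ?s)"
        by (rule runs_wp) (use k N s' one in \<open>auto simp: take_bit_nat_eq_self fun_upd_twist\<close>)
      moreover have "runs M ?loop ?s (m * (b + 3) + 1) (\<lambda>s'. J (Suc N) s' \<and> regs s' 0 = N)"
      proof (rule Suc.IH[of "Suc k"])
        show "J (Suc k) ?s" using s' frame by blast
      qed (use Suc.prems s' N k in \<open>auto simp: take_bit_nat_eq_self\<close>)
      ultimately show "runs M ?inc s' 2
         (\<lambda>s'. runs M ?loop s' (m * (b + 3) + 1) (\<lambda>s'. J (Suc N) s' \<and> regs s' 0 = N))"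
        by (auto elim!: runs_mono)
    qed simp
    then have "runs M ?loop s (Suc (b + 2 + (m * (b + 3) + 1)))
        (\<lambda>s'. J (Suc N) s' \<and> regs s' 0 = N)"
      by (intro runs_While_Suc) (use Suc.prems k one in auto)
    then show ?case by (auto elim!: runs_mono)
  qed
  let ?s = "s\<lparr>regs := (regs s)(2 := 0, 3 := 1)\<rparr>"
  have "runs M (Assign i e) s1 1 (\<lambda>s2. s2 = s1\<lparr>regs := (regs s1)(i := exp_val M e (regs s1))\<rparr>)"
    for i e s1
    unfolding runs_def by (intro exI conjI, rule exec.Assign) auto
  from this[of 2 "Lit 0" s] this[of 3 "Lit 1" "s\<lparr>regs := (regs s)(2 := 0)\<rparr>"]
  have "runs M (Assign 2 (Lit 0)) s 1 (\<lambda>s1. runs M (Assign 3 (Lit 1)) s1 1 (\<lambda>s2. s2 = ?s))"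
    using one by (auto elim!: runs_mono)
  moreover have "runs M ?loop ?s ((N + 1) * (b + 3) + 1) (\<lambda>s'. J (Suc N) s' \<and> regs s' 0 = N)"
    by (rule loop[of _ 0]) (use J s frame in auto)
  ultimately have "runs M (sweep c) s (1 + (1 + ((N + 1) * (b + 3) + 1)))
     (\<lambda>s'. J (Suc N) s' \<and> regs s' 0 = N)"
    unfolding sweep_def by (intro runs_Seq) (auto elim!: runs_mono intro!: runs_Seq simp del: One_nat_def)
  then show ?thesis by (auto elim!: runs_mono)
qed

text \<open>The number of iterations is the bit length of \<open>n - 1\<close>, which is \<open>\<lceil>log n\<rceil>\<close>.\<close>

definition levels :: "com \<Rightarrow> com" where
  "levels c = Seq (Assign 1 (Lit 0))
     (While (Binop Shr (Reg 0) (Reg 1)) (Seq c (Assign 1 (Binop Add (Reg 1) (Lit 1)))))"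

text \<open>The test \<open>N\<close> shifted right by \<open>t\<close> is nonzero iff
  \<open>2 ^ t \<le> N\<close>, which is the shape in which \<open>T\<close> is specified. The
  invariant may speak about register 1, so the body has to establish it for the state after the
  increment.\<close>

lemma runs_levels:
  fixes M :: machine
  assumes w: "wlen M \<ge> 1" and N: "N < 2 ^ wlen M"
    and T: "\<And>t. 2 ^ t \<le> N \<longleftrightarrow> t < T"
    and body: "\<And>t s. t < T \<Longrightarrow> J t s \<Longrightarrow> regs s 0 = N \<Longrightarrow> regs s 1 = t \<Longrightarrow>
      runs M c s b (\<lambda>s'. regs s' 0 = N \<and> regs s' 1 = t \<and>
        J (Suc t) (s'\<lparr>regs := (regs s')(1 := Suc t)\<rparr>))"
    and J: "J 0 (s\<lparr>regs := (regs s)(1 := 0)\<rparr>)" and s: "regs s 0 = N"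
  shows "runs M (levels c) s (T * (b + 2) + 2)
    (\<lambda>s'. J T s' \<and> regs s' 0 = N \<and> regs s' 1 = T)"
proof -
  let ?inc = "Assign 1 (Binop Add (Reg 1) (Lit 1))"
  let ?test = "Binop Shr (Reg 0) (Reg 1)"
  let ?loop = "While ?test (Seq c ?inc)"
  let ?Q = "\<lambda>s'. J T s' \<and> regs s' 0 = N \<and> regs s' 1 = T"
  have one: "take_bit (wlen M) (1 :: nat) = 1" using w by (simp add: take_bit_Suc_from_most)
  have "T \<le> wlen M"
    using T[of "wlen M"] N by simp
  then have Tw: "t \<le> T \<Longrightarrow> t < 2 ^ wlen M" for t
    by (meson le_less_trans less_exp order_trans)
  have test: "exp_val M ?test r = 0 \<longleftrightarrow> t \<ge> T" if "r 0 = N" "r 1 = t" "t \<le> T" for r t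
  proof -
    have "N div 2 ^ t < 2 ^ wlen M" using N by (meson div_le_dividend le_less_trans)
    moreover have "N div 2 ^ t = 0 \<longleftrightarrow> N < 2 ^ t" by (simp add: div_eq_0_iff)
    ultimately show ?thesis
      using that N Tw[of t] T[of t] by (auto simp: take_bit_nat_eq_self drop_bit_eq_div)
  qed
  have loop: "runs M ?loop s (m * (b + 2) + 1) ?Q"
    if "m = T - t" "t \<le> T" "J t s" "regs s 0 = N" "regs s 1 = t" for m t s
    using that
  proof (induction m arbitrary: t s)
    case 0
    then have "t = T" by simp
    then show ?case using 0 test[of "regs s" t]
      by (intro runs_mono[OF runs_While_0]) auto
  next
    case (Suc m)
    then have t: "t < T" by simp
    have "runs M (Seq c ?inc) s (b + 1) (\<lambda>s'. runs M ?loop s' (m * (b + 2) + 1) ?Q)"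
    proof (rule runs_Seq, rule runs_mono[OF body[of t s]])
      show "t < T" "J t s" "regs s 0 = N" "regs s 1 = t" using Suc.prems t by auto
    next
      fix s' assume s': "regs s' 0 = N \<and> regs s' 1 = t \<and>
        J (Suc t) (s'\<lparr>regs := (regs s')(1 := Suc t)\<rparr>)"
      let ?s = "s'\<lparr>regs := (regs s')(1 := Suc t)\<rparr>"
      have "runs M ?inc s' (cost ?inc) (\<lambda>s''. s'' = ?s)"
        by (rule runs_wp)
           (use t N s' one Tw[of t] Tw[of "Suc t"] in \<open>auto simp: take_bit_nat_eq_self\<close>)
      moreover have "runs M ?loop ?s (m * (b + 2) + 1) ?Q"
        by (rule Suc.IH[of "Suc t"]) (use Suc.prems s' in auto)
      ultimately show "runs M ?inc s' 1 (\<lambda>s'. runs M ?loop s' (m * (b + 2) + 1) ?Q)"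
        by (auto elim!: runs_mono)
    qed simp
    then have "runs M ?loop s (Suc (b + 1 + (m * (b + 2) + 1))) ?Q"
      by (intro runs_While_Suc) (use Suc.prems t test[of "regs s" t] in auto)
    then show ?case by (auto elim!: runs_mono)
  qed
  let ?s = "s\<lparr>regs := (regs s)(1 := 0)\<rparr>"
  have "runs M (Assign 1 (Lit 0)) s 1 (\<lambda>s1. s1 = ?s)"
    unfolding runs_def by (intro exI conjI, rule exec.Assign) auto
  moreover have "runs M ?loop ?s (T * (b + 2) + 1) ?Q"
    by (rule loop[of _ 0]) (use J s in auto)
  ultimately have "runs M (levels c) s (1 + (T * (b + 2) + 1)) ?Q"
    unfolding levels_def by (intro runs_Seq) (auto elim!: runs_mono)
  then show ?thesis by (auto elim!: runs_mono)
qed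

section \<open>Merge sort\<close>

text \<open>The runs are the aligned blocks of length \<open>u\<close>, the last one cut off at
  \<open>n\<close>.\<close>

definition runs_sorted :: "(nat \<Rightarrow> nat) \<Rightarrow> nat \<Rightarrow> nat \<Rightarrow> (nat \<Rightarrow> nat) \<Rightarrow> bool" where
  "runs_sorted g n u a \<longleftrightarrow> (\<forall>p q. p < q \<longrightarrow> q < n \<longrightarrow> p div u = q div u \<longrightarrow> g (a p) < g (a q))"

text \<open>The first \<open>i\<close> elements of the run starting at \<open>B\<close> and the first \<open>k - B - i\<close> elements of the
  run starting at \<open>B + u\<close> have been merged.\<close>

definition merging ::
    "(nat \<Rightarrow> nat) \<Rightarrow> nat \<Rightarrow> nat \<Rightarrow> (nat \<Rightarrow> nat) \<Rightarrow> nat \<Rightarrow> nat \<Rightarrow> nat \<Rightarrow> (nat \<Rightarrow> nat) \<Rightarrow> bool" where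
  "merging g n u a B k i o' \<longleftrightarrow>
     B + i \<le> k \<and> k \<le> n \<and> i \<le> u \<and> k \<le> B + u + i \<and> (B + i < k \<longrightarrow> k + u \<le> n + i) \<and>
     o' ` {B..<k} = a ` ({B..<B + i} \<union> {B + u..<k + u - i}) \<and>
     (\<forall>p q. B \<le> p \<longrightarrow> p < q \<longrightarrow> q < k \<longrightarrow> g (o' p) < g (o' q)) \<and>
     (\<forall>p \<in> {B..<k}. \<forall>q \<in> {B + i..<min n (B + u)} \<union> {k + u - i..<min n (B + 2 * u)}.
        g (o' p) < g (a q))"

lemma merging_init: "B \<le> n \<Longrightarrow> merging g n u a B B 0 o'"
  by (auto simp: merging_def)

lemma image_fun_upd_Suc:
  fixes f :: "nat \<Rightarrow> 'a"
  assumes "B \<le> k"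
  shows "(f(k := x)) ` {B..<Suc k} = insert x (f ` {B..<k})"
proof -
  have "(f(k := x)) ` {B..<k} = f ` {B..<k}" by (intro image_cong) auto
  moreover have "{B..<k} \<inter> {x. x \<noteq> k} = {B..<k}" by auto
  ultimately show ?thesis using assms by (simp add: atLeastLessThanSuc)
qed

text \<open>The head of the left run is below the rest of that run because runs are sorted, and
  below the rest of the right run because it is below the head \<open>k + u - i\<close> of the
  latter, unless nothing is left there. The position \<open>k + u - i\<close> is
  \<open>B + u\<close> plus the \<open>k - B - i\<close> elements already taken.\<close>

lemma merging_left:
  assumes "merging g n u a B k i o'" "k < n" "i < u" and a: "runs_sorted g n u a" and B: "u dvd B"
    and less: "k + u - i < min n (B + 2 * u) \<Longrightarrow> g (a (B + i)) < g (a (k + u - i))"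
  shows "merging g n u a B (Suc k) (Suc i) (o'(k := a (B + i)))"
proof -
  note m = assms(1)[unfolded merging_def]
  obtain b where b: "B = u * b" using B by blast
  have div: "q div u = b" if "B \<le> q" "q < B + u" for q
    by (rule div_nat_eqI) (use that b in simp_all)
  have div2: "q div u = Suc b" if "B + u \<le> q" "q < B + 2 * u" for q
    by (rule div_nat_eqI) (use that b in simp_all)
  have less1: "g (a (B + i)) < g (a q)" if "q \<in> {Suc (B + i)..<min n (B + u)}" for q
    using a[unfolded runs_sorted_def, rule_format, of "B + i" q] div[of "B + i"] div[of q] that
    by auto
  have less2: "g (a (B + i)) < g (a q)" if "q \<in> {k + u - i..<min n (B + 2 * u)}" for q
  proof (cases "q = k + u - i")
    case False
    have "g (a (k + u - i)) < g (a q)"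
      using a[unfolded runs_sorted_def, rule_format, of "k + u - i" q] div2[of "k + u - i"]
        div2[of q] that False m by auto
    then show ?thesis using less that by fastforce
  qed (use less that in auto)
  have eq: "Suc k + u - Suc i = k + u - i" by simp
  have img: "(o'(k := a (B + i))) ` {B..<Suc k} = insert (a (B + i)) (o' ` {B..<k})"
    by (rule image_fun_upd_Suc) (use m in simp)
  show ?thesis
    unfolding merging_def eq img
  proof (intro conjI)
    show "insert (a (B + i)) (o' ` {B..<k}) = a ` ({B..<B + Suc i} \<union> {B + u..<k + u - i})"
      using m by (auto simp: less_Suc_eq)
    show "\<forall>p q. B \<le> p \<longrightarrow> p < q \<longrightarrow> q < Suc k \<longrightarrow>
       g ((o'(k := a (B + i))) p) < g ((o'(k := a (B + i))) q)"
      using m assms(2,3) by (auto simp: less_Suc_eq)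
    show "\<forall>p \<in> {B..<Suc k}. \<forall>q \<in> {B + Suc i..<min n (B + u)} \<union> {k + u - i..<min n (B + 2 * u)}.
        g ((o'(k := a (B + i))) p) < g (a q)"
      using m assms(2,3) less1 less2 by (auto simp: less_Suc_eq)
  qed (use m assms(2,3) in auto)
qed

text \<open>Mirror image of \<open>merging_left\<close>; here the comparison is only required if the
  left run still has an element.\<close>

lemma merging_right:
  assumes "merging g n u a B k i o'" "k + u - i < min n (B + 2 * u)"
    and a: "runs_sorted g n u a" and B: "u dvd B"
    and less: "i < u \<Longrightarrow> g (a (k + u - i)) < g (a (B + i))"
  shows "merging g n u a B (Suc k) i (o'(k := a (k + u - i)))"
proof -
  note m = assms(1)[unfolded merging_def]
  obtain b where b: "B = u * b" using B by blast
  have div: "q div u = b" if "B \<le> q" "q < B + u" for q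
    by (rule div_nat_eqI) (use that b in simp_all)
  have div2: "q div u = Suc b" if "B + u \<le> q" "q < B + 2 * u" for q
    by (rule div_nat_eqI) (use that b in simp_all)
  have less1: "g (a (k + u - i)) < g (a q)" if "q \<in> {Suc k + u - i..<min n (B + 2 * u)}" for q
    using a[unfolded runs_sorted_def, rule_format, of "k + u - i" q] div2[of "k + u - i"]
      div2[of q] that m by auto
  have less2: "g (a (k + u - i)) < g (a q)" if q: "q \<in> {B + i..<min n (B + u)}" for q
  proof (cases "q = B + i")
    case False
    have "g (a (B + i)) < g (a q)"
      using a[unfolded runs_sorted_def, rule_format, of "B + i" q] div[of "B + i"] div[of q] that
        False by auto
    then show ?thesis using less q by fastforce
  qed (use less q in auto)
  have img: "(o'(k := a (k + u - i))) ` {B..<Suc k} = insert (a (k + u - i)) (o' ` {B..<k})"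
    by (rule image_fun_upd_Suc) (use m in simp)
  have "{B + u..<Suc k + u - i} = insert (k + u - i) {B + u..<k + u - i}" using m by auto
  then have img2: "insert (a (k + u - i)) (o' ` {B..<k}) =
      a ` ({B..<B + i} \<union> {B + u..<Suc k + u - i})"
    using m by auto
  show ?thesis
    unfolding merging_def img
  proof (intro conjI)
    show "\<forall>p q. B \<le> p \<longrightarrow> p < q \<longrightarrow> q < Suc k \<longrightarrow>
       g ((o'(k := a (k + u - i))) p) < g ((o'(k := a (k + u - i))) q)"
      using m assms(2) by (auto simp: less_Suc_eq)
    show "\<forall>p \<in> {B..<Suc k}. \<forall>q \<in> {B + i..<min n (B + u)} \<union> {Suc k + u - i..<min n (B + 2 * u)}.
        g ((o'(k := a (k + u - i))) p) < g (a q)"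
    proof (intro ballI)
      fix p q assume p: "p \<in> {B..<Suc k}"
        and q: "q \<in> {B + i..<min n (B + u)} \<union> {Suc k + u - i..<min n (B + 2 * u)}"
      have "q \<in> {B + i..<min n (B + u)} \<union> {k + u - i..<min n (B + 2 * u)}" using q by auto
      then have "g (o' p) < g (a q)" if "p \<noteq> k" using p m that by force
      moreover have "g (a (k + u - i)) < g (a q)" using less1[of q] less2[of q] q by auto
      ultimately show "g ((o'(k := a (k + u - i))) p) < g (a q)" by auto
    qed
  qed (use m assms(2) img2 in auto)
qed

text \<open>\<open>merged\<close> is the invariant of a sweep that merges the pairs of adjacent runs of length \<open>u\<close>.\<close>

definition merged ::
    "(nat \<Rightarrow> nat) \<Rightarrow> nat \<Rightarrow> nat \<Rightarrow> (nat \<Rightarrow> nat) \<Rightarrow> nat \<Rightarrow> nat \<Rightarrow> (nat \<Rightarrow> nat) \<Rightarrow> bool" where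
  "merged g n u a k i o' \<longleftrightarrow>
     (\<exists>B. 2 * u dvd B \<and> B \<le> k \<and> k \<le> B + 2 * u \<and> o' ` {..<B} = a ` {..<B} \<and>
        runs_sorted g B (2 * u) o' \<and> merging g n u a B k i o')"

text \<open>The bounds in \<open>merging\<close> leave two cases at the end of a block or of the
  array: nothing was taken from the right run, or the left run is used up, \<open>i = u\<close>.
  Either way the two source intervals add up to \<open>{B..<k}\<close>.\<close>

lemma merging_complete:
  assumes "merging g n u a B k i o'" "k = n \<or> k = B + 2 * u" "k \<le> B + 2 * u"
  shows "o' ` {B..<k} = a ` {B..<k}"
proof -
  have "{B..<B + i} \<union> {B + u..<k + u - i} = {B..<k}"
    using assms by (auto simp: merging_def)
  then show ?thesis using assms(1) by (auto simp: merging_def)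
qed

lemma merged_extend:
  assumes "2 * u dvd B" "B \<le> k" "k = n \<or> k = B + 2 * u" "k \<le> B + 2 * u"
    "o' ` {..<B} = a ` {..<B}" "runs_sorted g B (2 * u) o'" "merging g n u a B k i o'"
  shows "o' ` {..<k} = a ` {..<k}" "runs_sorted g k (2 * u) o'"
proof -
  have "{..<k} = {..<B} \<union> {B..<k}" using assms by auto
  then show "o' ` {..<k} = a ` {..<k}"
    using merging_complete[OF assms(7,3,4)] assms(5) by (simp add: image_Un)
  show "runs_sorted g k (2 * u) o'"
    unfolding runs_sorted_def
  proof (intro allI impI)
    fix p q assume pq: "p < q" "q < k" "p div (2 * u) = q div (2 * u)"
    obtain b where b: "B = 2 * u * b" using assms(1) by blast
    consider "q < B" | "p \<ge> B" | "p < B" "B \<le> q" by linarith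
    then show "g (o' p) < g (o' q)"
    proof cases
      case 1
      then show ?thesis using assms(6) pq by (auto simp: runs_sorted_def)
    next
      case 2
      then show ?thesis using assms(7) pq by (auto simp: merging_def)
    next
      \<comment> \<open>Vacuous: \<open>B\<close> is a multiple of \<open>2 * u\<close>, so
        positions on its two sides have different quotients.\<close>
      case 3
      then have "p div (2 * u) < b"
        using b by (metis less_mult_imp_div_less mult.commute)
      moreover have "b \<le> q div (2 * u)"
        using 3 b pq(2) assms(4)
        by (metis (no_types, lifting) add_cancel_right_right div_le_mono less_le_trans
            linorder_not_less mult_zero_left nonzero_mult_div_cancel_left not_less_iff_gr_or_eq
            mult_eq_0_iff)
      ultimately show ?thesis using pq by simp
    qed
  qed
qed

lemma merged_complete:
  assumes "merged g n u a n i o'"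
  shows "o' ` {..<n} = a ` {..<n}" "runs_sorted g n (2 * u) o'"
proof -
  obtain B where "2 * u dvd B" "B \<le> n" "n \<le> B + 2 * u" "o' ` {..<B} = a ` {..<B}"
    "runs_sorted g B (2 * u) o'" "merging g n u a B n i o'"
    using assms by (auto simp: merged_def)
  then show "o' ` {..<n} = a ` {..<n}" "runs_sorted g n (2 * u) o'"
    using merged_extend[of u B n n o' a g i] by blast+
qed

text \<open>At a multiple of \<open>2 * u\<close> the witness \<open>B\<close> in
  \<open>merged\<close> is ambiguous, as \<open>k\<close> may end one block or start another; then
  only the finished prefix is of interest. Elsewhere \<open>B\<close> is
  \<open>k - k mod (2 * u)\<close>, which the program recomputes by shifts instead of storing
  it.\<close>

lemma merged_step:
  assumes "merged g n u a k i o'" and k: "k < n" and u: "u > 0"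
  shows "2 * u dvd k \<Longrightarrow> o' ` {..<k} = a ` {..<k} \<and> runs_sorted g k (2 * u) o'"
    and "\<not> 2 * u dvd k \<Longrightarrow> o' ` {..<k - k mod (2 * u)} = a ` {..<k - k mod (2 * u)} \<and>
      runs_sorted g (k - k mod (2 * u)) (2 * u) o' \<and>
      merging g n u a (k - k mod (2 * u)) k i o'"
proof -
  obtain B where B: "2 * u dvd B" "B \<le> k" "k \<le> B + 2 * u" "o' ` {..<B} = a ` {..<B}"
    "runs_sorted g B (2 * u) o'" "merging g n u a B k i o'"
    using assms by (auto simp: merged_def)
  obtain b where b: "B = 2 * u * b" using B by blast
  {
    assume dvd: "2 * u dvd k"
    then have "2 * u dvd k - B" using B by simp
    then have "k = B \<or> k = B + 2 * u"
      using B(2,3) dvd_imp_le[of "2 * u" "k - B"] by linarith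
    then show "o' ` {..<k} = a ` {..<k} \<and> runs_sorted g k (2 * u) o'"
      using merged_extend[of u B k n o' a g i] B by auto
  }
  assume ndvd: "\<not> 2 * u dvd k"
  have "k \<noteq> B + 2 * u" using ndvd B(1) by auto
  then have "k - B < 2 * u" using B by auto
  then have "(2 * u * b + (k - B)) mod (2 * u) = k - B" by simp
  then have "k mod (2 * u) = k - B" using b B(2) by simp
  then have "k - k mod (2 * u) = B" using B by simp
  then show "o' ` {..<k - k mod (2 * u)} = a ` {..<k - k mod (2 * u)} \<and>
      runs_sorted g (k - k mod (2 * u)) (2 * u) o' \<and>
      merging g n u a (k - k mod (2 * u)) k i o'"
    using B by simp
qed

lemma merged_Suc:
  assumes "k < n" "u > 0" "o' ` {..<B} = a ` {..<B}" "runs_sorted g B (2 * u) o'"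
    "merging g n u a B (Suc k) i (o'(k := x))" "B = k - k mod (2 * u)"
  shows "merged g n u a (Suc k) i (o'(k := x))"
proof -
  have "B \<le> k" "2 * u dvd B" using assms(6) by (simp_all add: dvd_minus_mod)
  moreover have "Suc k \<le> B + 2 * u"
    using assms(2,6) mod_less_divisor[of "2 * u" k] by linarith
  moreover have "(o'(k := x)) ` {..<B} = o' ` {..<B}" using \<open>B \<le> k\<close> by (auto simp: image_iff)
  moreover have "runs_sorted g B (2 * u) (o'(k := x))"
    using assms(4) \<open>B \<le> k\<close> by (auto simp: runs_sorted_def)
  ultimately show ?thesis using assms unfolding merged_def by (intro exI[of _ B]) auto
qed

section \<open>Pre-processing\<close>

text \<open>A single element has no resolution to serve and is left to the final theorem. From
  \<open>n \<ge> 2\<close> one gets \<open>T \<ge> 1\<close>, so that dividing \<open>w\<close> into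
  fields of \<open>T\<close> bits makes sense.\<close>

locale preprocessing =
  fixes w :: nat and g h :: "nat \<Rightarrow> nat" and L :: "nat set" and n :: nat
  assumes w: "w \<ge> 1" and g: "g permutes Words w" and h: "h \<in> Words w \<rightarrow> {1..w}"
    and L: "L \<subseteq> Words w" and card_L: "card L = n" and n: "n \<ge> 2"
begin

text \<open>The arrays are: 0 the elements, 1 the merge buffer, 2 and 3 the words of the groups, 4
  and 5 their left ends, 6 the links, 7 the masks, 8 the packed table, 9 the saved answers, 10 the
  number \<open>T\<close>. The length \<open>2 * n\<close> is dictated by the group arrays, whose
  indices go up to \<open>2 ^ T - 1\<close>.\<close>

definition M :: machine where
  "M = \<lparr>wlen = w, gfun = g, hfun = h, narrays = 11, ncells = 2 * n\<rparr>"

lemma M_simps [simp]: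
  "wlen M = w" "gfun M = g" "hfun M = h" "narrays M = 11" "ncells M = 2 * n"
  by (simp_all add: M_def)

definition T :: nat where
  "T = nat \<lceil>log 2 (real n)\<rceil>"

lemma T_gt: "t < T \<longleftrightarrow> 2 ^ t < n"
proof -
  have "log 2 (real n) \<ge> 0" using n by simp
  have "t < T \<longleftrightarrow> int t < \<lceil>log 2 (real n)\<rceil>" unfolding T_def by linarith
  also have "\<dots> \<longleftrightarrow> real t < log 2 (real n)" by (simp add: less_ceiling_iff)
  also have "\<dots> \<longleftrightarrow> 2 powr real t < real n" using n by (simp add: less_log_iff)
  also have "\<dots> \<longleftrightarrow> real (2 ^ t) < real n" by (simp add: powr_realpow)
  also have "\<dots> \<longleftrightarrow> 2 ^ t < n" by (rule of_nat_less_iff)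
  finally show ?thesis .
qed

lemma n_le_T: "n \<le> 2 ^ T"
  using T_gt[of T] by simp

lemma n_le_w: "n \<le> 2 ^ w"
  using card_mono[OF _ L] card_L by (simp add: Words_def)

lemma T_le_w: "T \<le> w"
  using T_gt[of w] n_le_w by simp

lemma T_pos: "T \<ge> 1"
  using T_gt[of 0] n by simp

lemma pow_T_less: "2 ^ T < 2 * n"
proof -
  have "2 ^ (T - 1) < n" using T_gt[of "T - 1"] T_pos by simp
  then show ?thesis using T_pos by (cases T) auto
qed

lemma le_w_word: "k \<le> w \<Longrightarrow> k < 2 ^ w"
  by (erule le_less_trans) (rule less_exp)

lemma less_n_word: "p < n \<Longrightarrow> p < 2 ^ w"
  using n_le_w by simp

lemma word_g: "x \<in> Words w \<Longrightarrow> take_bit w (g x) = g x"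
  using permutes_in_image[OF g, of x] by (auto simp: Words_def intro!: take_bit_nat_eq_self)

lemma word_id: "x \<in> Words w \<Longrightarrow> take_bit w x = x"
  by (auto simp: Words_def intro!: take_bit_nat_eq_self)

lemma inj_g: "g x = g y \<longleftrightarrow> x = y"
  using permutes_inj[OF g] by (auto dest: injD)

lemmas word_simps = take_bit_nat_eq_self take_bit_sub and_of_bool
  take_bit_of_bool_word[OF w] word_id word_g

end

text \<open>Register 4 counts the elements taken from the left one of the two runs being merged.\<close>

definition merge_body :: com where
  "merge_body = block
    [Assign 5 (Binop Add (Reg 1) (Lit 1)),
     Assign 5 (Binop Shl (Binop Shr (Reg 2) (Reg 5)) (Reg 5)),
     Cond (Binop Eq (Reg 5) (Reg 2)) (Assign 4 (Lit 0)) Skip,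
     Assign 6 (Binop Shl (Lit 1) (Reg 1)),
     Assign 7 (Binop Sub (Binop Sub (Reg 2) (Reg 5)) (Reg 4)),
     Assign 8 (Binop Add (Binop Add (Reg 5) (Reg 6)) (Reg 7)),
     Load 9 0 (Binop Add (Reg 5) (Reg 4)),
     Assign 11 (Lit 1),
     Cond (Binop And (Binop Less (Reg 7) (Reg 6)) (Binop Eq (Binop Less (Reg 0) (Reg 8)) (Lit 0)))
       (block
         [Load 10 0 (Reg 8),
          Assign 11 (Binop And (Binop Less (Reg 4) (Reg 6))
                               (Binop Less (GVal (Reg 9)) (GVal (Reg 10))))])
       Skip,
     Cond (Reg 11)
       (block [Store 1 (Reg 2) (Reg 9), Assign 4 (Binop Add (Reg 4) (Lit 1))])
       (Store 1 (Reg 2) (Reg 10))]"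

definition copy_body :: com where
  "copy_body = block [Load 5 1 (Reg 2), Store 0 (Reg 2) (Reg 5)]"

context preprocessing
begin

text \<open>For \<open>k = 0\<close> nothing is said about register 4 or the buffer, since
  \<open>merge_body\<close> resets register 4 at the start of every block.\<close>

definition merge_inv :: "nat \<Rightarrow> (nat \<Rightarrow> nat) \<Rightarrow> nat \<Rightarrow> state \<Rightarrow> bool" where
  "merge_inv t a k s \<longleftrightarrow> arrs s 0 = a \<and> (\<forall>i\<ge>2. arrs s i = (\<lambda>_. 0)) \<and> regs s 1 = t \<and>
     (k = 0 \<or> merged g n (2 ^ t) a k (regs s 4) (arrs s 1))"

text \<open>A block may extend past \<open>n\<close>, but \<open>n \<le> 2 ^ T\<close> and
  \<open>2 ^ T\<close> is a multiple of the block length, so it ends at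
  \<open>2 ^ T \<le> 2 ^ w\<close> at the latest. Addresses inside a block therefore do not
  wrap.\<close>

lemma block_end_le:
  assumes "t < T" "k < n"
  shows "k - k mod (2 * 2 ^ t) + 2 * 2 ^ t \<le> 2 ^ w"
proof -
  let ?b = "k div (2 ^ Suc t)"
  have T: "(2::nat) ^ T = 2 ^ Suc t * 2 ^ (T - Suc t)"
    using assms(1) by (simp only: power_add[symmetric]) simp
  then have "k < 2 ^ (T - Suc t) * 2 ^ Suc t" using assms(2) n_le_T by (simp add: mult.commute)
  then have "?b < 2 ^ (T - Suc t)" by (rule less_mult_imp_div_less)
  then have "2 ^ Suc t * Suc ?b \<le> 2 ^ Suc t * 2 ^ (T - Suc t)" by (intro mult_le_mono2) simp
  also have "\<dots> \<le> 2 ^ w" unfolding T[symmetric] using T_le_w by simp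
  finally show ?thesis by (simp add: minus_mod_eq_mult_div)
qed

lemma merge_body_correct:
  assumes s: "merge_inv t a k s" "regs s 0 = n - 1" "regs s 2 = k" and k: "k \<le> n - 1"
    and t: "t < T" and a: "a ` {..<n} = L" "runs_sorted g n (2 ^ t) a"
  shows "wp M merge_body
    (\<lambda>s'. merge_inv t a (Suc k) s' \<and> regs s' 0 = n - 1 \<and> regs s' 2 = k) s"
proof -
  let ?u = "2 ^ t :: nat"
  define B where "B = k - k mod (2 * ?u)"
  \<comment> \<open>The value of register 4 after the reset at a block start.\<close>
  define i where "i = (if B = k then 0 else regs s 4)"
  define o' where "o' = arrs s 1"
  let ?q = "k + ?u - i"
  note s = s[unfolded merge_inv_def]
  have kn: "k < n" using k n by simp
  have Bk: "B = k \<longleftrightarrow> 2 * ?u dvd k"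
    using mod_less_eq_dividend[of k "2 * ?u"] unfolding B_def dvd_eq_mod_eq_0 by linarith
  have inv: "o' ` {..<B} = a ` {..<B} \<and> runs_sorted g B (2 * ?u) o' \<and> merging g n ?u a B k i o'"
  proof (cases "k = 0")
    case True
    then show ?thesis using merging_init[of 0 n g ?u a o'] unfolding B_def i_def
      by (simp add: runs_sorted_def)
  next
    case False
    then have "merged g n ?u a k (regs s 4) o'" using s unfolding o'_def by simp
    note step = merged_step[OF this kn]
    show ?thesis
    proof (cases "2 * ?u dvd k")
      case True
      then have "B = k" "i = 0" using Bk by (auto simp: i_def)
      then show ?thesis using step(1) True kn merging_init[of k n] by simp
    next
      case False
      then have "i = regs s 4" using Bk by (auto simp: i_def)
      then show ?thesis using step(2) False unfolding B_def by simp
    qed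
  qed
  then have m: "B + i \<le> k" "i \<le> ?u" "k \<le> B + ?u + i"
    unfolding merging_def by auto
  have dvd: "?u dvd B"
  proof -
    have "2 * ?u dvd B" unfolding B_def by (rule dvd_minus_mod)
    then show ?thesis by (rule dvd_mult_right)
  qed
  have end_le: "B + 2 * ?u \<le> 2 ^ w" unfolding B_def using block_end_le t kn .
  have k_end: "k < B + 2 * ?u"
  proof -
    have "k mod (2 * ?u) < 2 * ?u" by simp
    then show ?thesis unfolding B_def by linarith
  qed
  have tw: "t < 2 ^ w" "Suc t < 2 ^ w" "k < 2 ^ w" "n - 1 < 2 ^ w" "B < 2 ^ w" "B + ?u < 2 ^ w"
      "i < 2 ^ w" "?u < 2 ^ w"
    using t T_le_w le_w_word[of t] le_w_word[of "Suc t"] less_n_word[OF kn] n_le_w n end_le m k by auto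
  have word: "a p \<in> Words w" if "p < n" for p using a(1) L that by blast
  have db: "drop_bit (Suc t) k < 2 ^ w"
    unfolding drop_bit_eq_div using tw(3) by (meson div_le_dividend le_less_trans)
  have base: "push_bit (Suc t) (drop_bit (Suc t) k) = B"
    by (simp add: B_def push_bit_eq_mult drop_bit_eq_div minus_mod_eq_mult_div)
  have leftD: "merged g n ?u a (Suc k) (Suc i) (o'(k := a (B + i)))"
    if "i < ?u" "?q < min n (B + 2 * ?u) \<Longrightarrow> g (a (B + i)) < g (a ?q)"
    using merged_Suc[OF kn _ _ _ merging_left[OF _ kn that(1) a(2) dvd that(2)], of o'] inv
    by (simp add: B_def)
  have rightD: "merged g n ?u a (Suc k) i (o'(k := a ?q))"
    if "?q < min n (B + 2 * ?u)" "i < ?u \<Longrightarrow> g (a ?q) < g (a (B + i))"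
    using merged_Suc[OF kn _ _ _ merging_right[OF _ that(1) a(2) dvd that(2)], of o'] inv
    by (simp add: B_def)
  define j where "j = k - B - i"
  \<comment> \<open>If the right run is used up, \<open>j = ?u\<close>, then
    \<open>B + ?u + j\<close> can be \<open>2 ^ w\<close> and wrap to 0. Hence \<open>q\<close> is
    trusted only together with \<open>j < ?u\<close>.\<close>
  define q where "q = take_bit w (B + ?u + j)"
  define left where "left \<longleftrightarrow> (j < ?u \<and> q < n \<longrightarrow> i < ?u \<and> g (a (B + i)) < g (a q))"
  have q_eq: "q = ?q" if "j < ?u"
  proof -
    have "B + ?u + j = ?q" using m unfolding j_def by simp
    moreover have "?q < 2 ^ w" using that end_le m unfolding j_def by simp
    ultimately show ?thesis unfolding q_def by (simp add: take_bit_nat_eq_self)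
  qed
  have cond: "j < ?u \<and> q < n \<longleftrightarrow> ?q < min n (B + 2 * ?u)"
  proof
    assume "j < ?u \<and> q < n"
    then show "?q < min n (B + 2 * ?u)" using q_eq m unfolding j_def by auto
  next
    assume "?q < min n (B + 2 * ?u)"
    moreover from this have "j < ?u" using m unfolding j_def by auto
    ultimately show "j < ?u \<and> q < n" using q_eq by auto
  qed
  \<comment> \<open>With the left run used up, the head of the right run is \<open>k\<close> itself,
    which lies below both \<open>n\<close> and the end of the block; so the comparison takes place
    and yields false.\<close>
  have left1: "i < ?u" if left
  proof (rule ccontr)
    assume "\<not> i < ?u"
    then have "i = ?u" using m by simp
    then have "?q < min n (B + 2 * ?u)" using kn k_end by simp
    then show False using that cond \<open>\<not> i < ?u\<close> unfolding left_def by blast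
  qed
  have left2: "merged g n ?u a (Suc k) (Suc i) (o'(k := a (B + i)))" if left
  proof (rule leftD[OF left1[OF that]])
    assume "?q < min n (B + 2 * ?u)"
    then show "g (a (B + i)) < g (a ?q)" using that cond q_eq unfolding left_def by auto
  qed
  have right: "merged g n ?u a (Suc k) i (o'(k := a q))" "q < n" if "\<not> left"
  proof -
    have *: "j < ?u" "q < n" "\<not> (i < ?u \<and> g (a (B + i)) < g (a q))"
      using that unfolding left_def by auto
    then have q: "?q = q" "?q < min n (B + 2 * ?u)" using q_eq cond by auto
    moreover have "g (a ?q) < g (a (B + i))" if "i < ?u"
    proof -
      \<comment> \<open>The failed comparison only gives \<open>\<le>\<close>; \<open>a\<close>
        enumerates the \<open>n\<close> elements of \<open>L\<close> without repetition, which makes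
        it strict.\<close>
      have "inj_on a {..<n}" using a(1) card_L by (intro eq_card_imp_inj_on) auto
      moreover have "q \<noteq> B + i" using q(1) that m by simp
      ultimately have "g (a q) \<noteq> g (a (B + i))" using *(2) kn m inj_g by (auto dest: inj_onD)
      then show ?thesis using *(3) that q(1) by simp
    qed
    ultimately show "merged g n ?u a (Suc k) i (o'(k := a q))" using rightD by simp
    show "q < n" by fact
  qed
  show "wp M merge_body
    (\<lambda>s'. merge_inv t a (Suc k) s' \<and> regs s' 0 = n - 1 \<and> regs s' 2 = k) s"
    unfolding merge_body_def
    apply (rule wp_start)
    apply (rule wp_block_Assign[where v = "Suc t"])
    subgoal using s tw w by (simp add: word_simps)
    apply (rule wp_block_Assign[where v = B])
    subgoal using s tw w base db by (simp add: word_simps)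
    apply (rule wp_block_mid[where P = "\<lambda>s'. arrs s' = arrs s \<and> regs s' 0 = n - 1 \<and> regs s' 1 = t \<and>
      regs s' 2 = k \<and> regs s' 4 = i \<and> regs s' 5 = B"])
    subgoal using s tw w by (simp add: word_simps i_def)
    subgoal premises s' for s'
      apply (rule wp_start)
      apply (rule wp_block_Assign[where v = ?u])
      subgoal using s' tw w by (simp add: word_simps push_bit_eq_mult)
      apply (rule wp_block_Assign[where v = j])
      subgoal using s' tw w m by (simp add: word_simps j_def)
      apply (rule wp_block_Assign[where v = q])
      subgoal using s' tw w m by (simp add: word_simps j_def q_def)
      \<comment> \<open>For \<open>i = ?u\<close> this reads beyond the left run, but
        \<open>B + i \<le> k < n\<close> keeps it in range and the test \<open>i < ?u\<close>
        rejects the element.\<close>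
      apply (rule wp_block_Load[where v = "B + i" and u = "a (B + i)"])
      subgoal using s' tw w m by (simp add: word_simps)
      subgoal by simp
      subgoal using kn m by simp
      subgoal using s s' by simp
      apply (rule wp_block_Assign[where v = 1])
      subgoal using w by simp
      apply (rule wp_block_mid[where P = "\<lambda>s'. arrs s' = arrs s \<and> regs s' 0 = n - 1 \<and>
        regs s' 1 = t \<and> regs s' 2 = k \<and> regs s' 4 = i \<and> regs s' 9 = a (B + i) \<and>
        regs s' 11 = of_bool left \<and> (\<not> left \<longrightarrow> regs s' 10 = a q)"])
      subgoal
        apply (rule wp_Cond[where v = "of_bool (j < ?u \<and> q < n)"])
        subgoal using s' tw w n by (simp add: word_simps q_def j_def) linarith
        subgoal premises v
          apply (rule wp_block_Load[where v = q and u = "a q"])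
          subgoal using s' v n_le_w by (simp add: word_simps)
          subgoal by simp
          subgoal using v by (simp split: if_splits)
          subgoal using s s' by simp
          apply (rule wp_block_Assign[where v = "of_bool left"])
          subgoal using s' v tw w kn m word[of "B + i"] word[of q]
            by (simp add: word_simps left_def)
          apply (rule wp_block_Nil)
          using s' by simp
        subgoal premises v
          apply (rule wp_Skip)
          using s' v by (auto simp: left_def)
        done
      subgoal premises s'' for s''
        apply (rule wp_start)
        apply (rule wp_block_Cond[where v = "of_bool left"])
        subgoal using s'' w by (simp add: word_simps)
        subgoal premises v
          apply (rule wp_block_block, simp only: append.simps)
          apply (rule wp_block_Store[where v = k and u = "a (B + i)"])
          subgoal using s'' tw by (simp add: word_simps)
          subgoal by simp
          subgoal using kn by simp
          subgoal using s'' word[of "B + i"] m kn by (simp add: word_simps)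
          apply (rule wp_block_Assign[where v = "Suc i"])
          subgoal using s'' v left1 tw by (simp add: word_simps)
          apply (rule wp_block_Nil)
          using s s'' v left2 by (simp add: merge_inv_def o'_def)
        subgoal premises v
          apply (rule wp_block_Store[where v = k and u = "a q"])
          subgoal using s'' tw by (simp add: word_simps)
          subgoal by simp
          subgoal using kn by simp
          subgoal using s'' v word[of q] right(2) by (simp add: word_simps)
          apply (rule wp_block_Nil)
          using s s'' v right by (simp add: merge_inv_def o'_def)
        done
      done
    done
qed

end

definition sort_level :: com where
  "sort_level = Seq (sweep merge_body) (sweep copy_body)"

definition sort_level_time :: "nat \<Rightarrow> nat" where
  "sort_level_time n = (n * (cost merge_body + 3) + 3) + (n * (cost copy_body + 3) + 3)"

context preprocessing
begin

lemma N: "n - 1 < 2 ^ w" "Suc (n - 1) = n" "n - 1 + 1 = n"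
  using n n_le_w by auto

lemma T_gt': "2 ^ t \<le> n - 1 \<longleftrightarrow> t < T"
  using T_gt[of t] n by auto

definition sort_inv :: "nat \<Rightarrow> state \<Rightarrow> bool" where
  "sort_inv t s \<longleftrightarrow> arrs s 0 ` {..<n} = L \<and> runs_sorted g n (2 ^ t) (arrs s 0) \<and>
     (\<forall>i\<ge>2. arrs s i = (\<lambda>_. 0))"

lemma sort_level_correct:
  assumes s: "sort_inv t s" "regs s 0 = n - 1" "regs s 1 = t" and t: "t < T"
  shows "runs M sort_level s (sort_level_time n)
    (\<lambda>s'. regs s' 0 = n - 1 \<and> regs s' 1 = t \<and> sort_inv (Suc t) (s'\<lparr>regs := (regs s')(1 := Suc t)\<rparr>))"
proof -
  let ?a = "arrs s 0"
  have a: "?a ` {..<n} = L" "runs_sorted g n (2 ^ t) ?a" using s by (auto simp: sort_inv_def)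
  have merge: "runs M (sweep merge_body) s (n * (cost merge_body + 3) + 3)
      (\<lambda>s'. merge_inv t ?a n s' \<and> regs s' 0 = n - 1)"
  proof -
    have "runs M (sweep merge_body) s ((n - 1 + 1) * (cost merge_body + 3) + 3)
        (\<lambda>s'. merge_inv t ?a (Suc (n - 1)) s' \<and> regs s' 0 = n - 1)"
    proof (rule runs_sweep)
      show "merge_inv t ?a 0 s" using s by (auto simp: merge_inv_def sort_inv_def)
      show "runs M merge_body s (cost merge_body)
          (\<lambda>s'. merge_inv t ?a (Suc k) s' \<and> regs s' 0 = n - 1 \<and> regs s' 2 = k)"
        if "k \<le> n - 1" "merge_inv t ?a k s" "regs s 0 = n - 1" "regs s 2 = k" for k s
        by (rule runs_wp, rule merge_body_correct) (use that t a in auto)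
    qed (use w N s in \<open>auto simp: merge_inv_def\<close>)
    then show ?thesis using n by simp
  qed
  define copy_inv where "copy_inv o' k s' \<longleftrightarrow> regs s' 1 = t \<and> arrs s' 1 = o' \<and>
    (\<forall>i\<ge>2. arrs s' i = (\<lambda>_. 0)) \<and> (\<forall>p<k. arrs s' 0 p = o' p)" for o' k and s' :: state
  have copy: "runs M (sweep copy_body) s1 (n * (cost copy_body + 3) + 3)
      (\<lambda>s'. copy_inv (arrs s1 1) n s' \<and> regs s' 0 = n - 1)"
    if s1: "merge_inv t ?a n s1" "regs s1 0 = n - 1" for s1
  proof -
    have "arrs s1 1 ` {..<n} = L"
      using merged_complete[of g n "2 ^ t" ?a "regs s1 4" "arrs s1 1"] s1 n a
      by (simp add: merge_inv_def)
    then have word: "arrs s1 1 p \<in> Words w" if "p < n" for p using L that by blast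
    have "runs M (sweep copy_body) s1 ((n - 1 + 1) * (cost copy_body + 3) + 3)
        (\<lambda>s'. copy_inv (arrs s1 1) (Suc (n - 1)) s' \<and> regs s' 0 = n - 1)"
    proof (rule runs_sweep)
      show "copy_inv (arrs s1 1) 0 s1" using s1 by (auto simp: merge_inv_def copy_inv_def)
      show "runs M copy_body s (cost copy_body)
          (\<lambda>s'. copy_inv (arrs s1 1) (Suc k) s' \<and> regs s' 0 = n - 1 \<and> regs s' 2 = k)"
        if k: "k \<le> n - 1" and s: "copy_inv (arrs s1 1) k s" "regs s 0 = n - 1" "regs s 2 = k"
        for k s
      proof (rule runs_wp)
        have kn: "k < n" using k n by simp
        show "wp M copy_body
          (\<lambda>s'. copy_inv (arrs s1 1) (Suc k) s' \<and> regs s' 0 = n - 1 \<and> regs s' 2 = k) s"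
          using s kn less_n_word[OF kn] word[OF kn]
          by (simp add: copy_body_def word_simps copy_inv_def less_Suc_eq)
      qed
    qed (use w N s1 in \<open>auto simp: copy_inv_def\<close>)
    then show ?thesis using n by simp
  qed
  show ?thesis
    unfolding sort_level_def sort_level_time_def
  proof (rule runs_Seq, rule runs_mono[OF merge])
    fix s1 assume s1: "merge_inv t ?a n s1 \<and> regs s1 0 = n - 1"
    have o': "arrs s1 1 ` {..<n} = L" "runs_sorted g n (2 ^ Suc t) (arrs s1 1)"
      using merged_complete[of g n "2 ^ t" ?a "regs s1 4" "arrs s1 1"] s1 n a
      by (simp_all add: merge_inv_def)
    show "runs M (sweep copy_body) s1 (n * (cost copy_body + 3) + 3)
      (\<lambda>s'. regs s' 0 = n - 1 \<and> regs s' 1 = t \<and>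
         sort_inv (Suc t) (s'\<lparr>regs := (regs s')(1 := Suc t)\<rparr>))"
    proof (rule runs_mono[OF copy])
      fix s' assume s': "copy_inv (arrs s1 1) n s' \<and> regs s' 0 = n - 1"
      then have "arrs s' 0 p = arrs s1 1 p" if "p < n" for p
        using that by (simp add: copy_inv_def)
      then have "arrs s' 0 ` {..<n} = L" "runs_sorted g n (2 ^ Suc t) (arrs s' 0)"
        using o' by (auto simp: runs_sorted_def)
      then show "regs s' 0 = n - 1 \<and> regs s' 1 = t \<and>
         sort_inv (Suc t) (s'\<lparr>regs := (regs s')(1 := Suc t)\<rparr>)"
        using s' by (simp add: sort_inv_def copy_inv_def)
    qed (use s1 in auto)
  qed simp
qed

definition sorted_array :: "(nat \<Rightarrow> nat) \<Rightarrow> bool" where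
  "sorted_array a \<longleftrightarrow> a ` {..<n} = L \<and> (\<forall>p q. p < q \<longrightarrow> q < n \<longrightarrow> g (a p) < g (a q))"

lemma sort_correct:
  assumes "arrs s 0 ` {..<n} = L" "\<And>i. i \<ge> 2 \<Longrightarrow> arrs s i = (\<lambda>_. 0)" "regs s 0 = n - 1"
  shows "runs M (levels sort_level) s (T * (sort_level_time n + 2) + 2)
    (\<lambda>s'. sorted_array (arrs s' 0) \<and> (\<forall>i\<ge>2. arrs s' i = (\<lambda>_. 0)) \<and> regs s' 0 = n - 1)"
proof (rule runs_mono[OF runs_levels[of M "n - 1" T sort_inv]])
  show "sort_inv 0 (s\<lparr>regs := (regs s)(1 := 0)\<rparr>)"
    using assms by (simp add: sort_inv_def runs_sorted_def)
  fix s' assume s': "sort_inv T s' \<and> regs s' 0 = n - 1 \<and> regs s' 1 = T"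
  \<comment> \<open>Runs of length \<open>2 ^ T\<close> cover the whole array.\<close>
  have "p div 2 ^ T = 0" if "p < n" for p using that n_le_T by simp
  then show "sorted_array (arrs s' 0) \<and> (\<forall>i\<ge>2. arrs s' i = (\<lambda>_. 0)) \<and> regs s' 0 = n - 1"
    using s' by (auto simp: sort_inv_def sorted_array_def runs_sorted_def)
qed (use w N assms sort_level_correct T_gt' in auto)

end

section \<open>The groups of all resolutions\<close>

text \<open>The group of \<open>z \<in> {0,1}^t\<close> is described in the cell \<open>node_idx t z\<close> of two arrays, which are
  chosen by the parity of \<open>z\<close>: heap numbering of all groups would need \<open>w + 1\<close> bits.\<close>

definition node_idx :: "nat \<Rightarrow> nat \<Rightarrow> nat" where
  "node_idx t z = 2 ^ (t - 1) + z div 2"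

lemma node_idx_less: "1 \<le> t \<Longrightarrow> z < 2 ^ t \<Longrightarrow> node_idx t z < 2 ^ t"
  by (cases t) (auto simp: node_idx_def)

text \<open>Resolution \<open>t\<close> occupies the cells from \<open>2 ^ (t - 1)\<close> to
  \<open>2 ^ t - 1\<close>, so different resolutions never meet; within one, \<open>z div 2\<close>
  and the parity determine \<open>z\<close>.\<close>

lemma node_idx_inj:
  assumes "1 \<le> t" "z < 2 ^ t" "1 \<le> t'" "z' < 2 ^ t'"
    and eq: "z mod 2 = z' mod 2" "node_idx t z = node_idx t' z'"
  shows "t = t' \<and> z = z'"
proof -
  have "\<not> u < u'" if "1 \<le> u" "y < 2 ^ u" "1 \<le> u'" "y' < 2 ^ u'" "node_idx u y = node_idx u' y'"
    for u u' y y'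
  proof
    assume "u < u'"
    then have "(2::nat) ^ u \<le> 2 ^ (u' - 1)" by (intro power_increasing) auto
    also have "\<dots> \<le> node_idx u' y'" by (simp add: node_idx_def)
    finally show False using node_idx_less[OF that(1,2)] that(5) by simp
  qed
  then have "t = t'" using assms by (metis linorder_neqE_nat)
  moreover from this have "z div 2 = z' div 2" using eq by (simp add: node_idx_def)
  ultimately show ?thesis using eq(1) by (metis div_mult_mod_eq)
qed

definition node_update :: "nat \<Rightarrow> nat \<Rightarrow> com" where
  "node_update a b = block
    [Load 9 a (Reg 7), Store a (Reg 7) (Binop Or (Reg 9) (Reg 8)), Store b (Reg 7) (Reg 4)]"

text \<open>Round \<open>k\<close> treats position \<open>n - 1 - k\<close>. Since positions
  descend, overwriting the left end each time leaves the smallest position of the group. Register 1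
  counts from 0, so the prefix taken has one bit more than its value.\<close>

definition node_body :: com where
  "node_body = block
    [Assign 4 (Binop Sub (Reg 0) (Reg 2)),
     Load 5 0 (Reg 4),
     Assign 6 (Binop Shr (GVal (Reg 5)) (Binop Sub Width (Binop Add (Reg 1) (Lit 1)))),
     Assign 7 (Binop Add (Binop Shl (Lit 1) (Reg 1)) (Binop Shr (Reg 6) (Lit 1))),
     Assign 8 (Binop Shl (Lit 1) (Binop Sub (HVal (Reg 5)) (Lit 1))),
     Cond (Binop And (Reg 6) (Lit 1)) (node_update 3 5) (node_update 2 4)]"

locale sorted_input = preprocessing +
  fixes a :: "nat \<Rightarrow> nat"
  assumes sorted: "sorted_array a"
begin

abbreviation colour :: "nat \<Rightarrow> nat" where
  "colour p \<equiv> h (a p)"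

abbreviation prefix_of :: "nat \<Rightarrow> nat \<Rightarrow> nat" where
  "prefix_of t p \<equiv> top_bits w t (g (a p))"

lemma image_a: "a ` {..<n} = L"
  using sorted by (simp add: sorted_array_def)

lemma g_a_less: "p < q \<Longrightarrow> q < n \<Longrightarrow> g (a p) < g (a q)"
  using sorted by (simp add: sorted_array_def)

lemma g_a_le: "p \<le> q \<Longrightarrow> q < n \<Longrightarrow> g (a p) \<le> g (a q)"
  using g_a_less[of p q] by (cases "p = q") auto

lemma word_a: "p < n \<Longrightarrow> a p \<in> Words w"
  using image_a L by blast

lemma word_g_a: "p < n \<Longrightarrow> g (a p) < 2 ^ w"
  using permutes_in_image[OF g, of "a p"] word_a[of p] by (simp add: Words_def)

lemma colour_bounds: "p < n \<Longrightarrow> 1 \<le> colour p" "p < n \<Longrightarrow> colour p \<le> w"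
  using h word_a[of p] by (auto simp: Pi_iff)

lemma prefix_of_less:
  assumes "p < n" "t \<le> w"
  shows "prefix_of t p < 2 ^ t"
proof -
  have "g (a p) < 2 ^ t * 2 ^ (w - t)"
    using word_g_a[OF assms(1)] assms(2) by (simp flip: power_add)
  then show ?thesis
    by (simp add: top_bits_def drop_bit_eq_div less_mult_imp_div_less)
qed

lemma prefix_of_mono: "p \<le> q \<Longrightarrow> q < n \<Longrightarrow> prefix_of t p \<le> prefix_of t q"
  using g_a_le[of p q] by (simp add: top_bits_def drop_bit_eq_div div_le_mono)

text \<open>\<open>S\<close> is the set of positions treated so far. The cell for the left end is
  unconstrained while the group is empty.\<close>

definition node_ok :: "(nat \<Rightarrow> nat \<Rightarrow> nat) \<Rightarrow> nat \<Rightarrow> nat \<Rightarrow> nat set \<Rightarrow> bool" where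
  "node_ok A t z S \<longleftrightarrow>
     (let v = A (2 + z mod 2) (node_idx t z); l = A (4 + z mod 2) (node_idx t z) in
      v < 2 ^ w \<and> (\<forall>k<w. bit v k \<longleftrightarrow> (\<exists>p\<in>S. prefix_of t p = z \<and> colour p = Suc k)) \<and>
      (\<forall>p\<in>S. prefix_of t p = z \<longrightarrow> l \<le> p \<and> l \<in> S \<and> prefix_of t l = z))"

text \<open>The new position precedes all of \<open>S\<close>, so it is the left end of its group;
  every other group of this resolution uses another cell.\<close>

lemma node_ok_insert:
  assumes p: "p < n" "\<And>q. q \<in> S \<Longrightarrow> p < q" and S: "S \<subseteq> {..<n}" and t: "1 \<le> t" "t \<le> w"
    and z: "z < 2 ^ t"
    and A: "node_ok A t z S"
    and A': "A' = A(2 + r := (A (2 + r))(i := Bit_Operations.or (A (2 + r) i) (2 ^ (colour p - 1))),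
      4 + r := (A (4 + r))(i := p))"
    and ri: "r = prefix_of t p mod 2" "i = node_idx t (prefix_of t p)"
  shows "node_ok A' t z (insert p S)"
proof (cases "z = prefix_of t p")
  case True
  have "(2::nat) ^ (colour p - 1) < 2 ^ w" using colour_bounds[OF p(1)] by simp
  then have "Bit_Operations.or v (2 ^ (colour p - 1)) < 2 ^ w" if "v < 2 ^ w" for v :: nat
    using that by (metis take_bit_nat_eq_self_iff take_bit_or)
  moreover have "bit (2 ^ (colour p - 1) :: nat) k \<longleftrightarrow> colour p = Suc k" for k
    using colour_bounds[OF p(1)] by (auto simp: bit_exp_iff)
  moreover have "r \<noteq> 2 + r" "r < 2" using ri by auto
  ultimately show ?thesis
    using True A p(2) unfolding node_ok_def A' ri[symmetric] Let_def
    by (auto simp: bit_or_iff ri[symmetric] less_imp_le)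
next
  case False
  then have "z mod 2 \<noteq> r \<or> node_idx t z \<noteq> i"
    using node_idx_inj[OF t(1) z t(1) prefix_of_less[OF p(1) t(2)]] ri by blast
  moreover have "r < 2" "z mod 2 < 2" using ri by auto
  ultimately have "A' (2 + z mod 2) (node_idx t z) = A (2 + z mod 2) (node_idx t z)"
    "A' (4 + z mod 2) (node_idx t z) = A (4 + z mod 2) (node_idx t z)"
    unfolding A' by auto
  then show ?thesis using False A unfolding node_ok_def Let_def by auto
qed

lemma node_ok_other:
  assumes p: "p < n" and t: "1 \<le> t" "t \<le> w" "1 \<le> t'" "t \<noteq> t'" and z: "z < 2 ^ t'"
    and A: "node_ok A t' z S"
    and A': "A' = A(2 + r := (A (2 + r))(i := v), 4 + r := (A (4 + r))(i := p))"
    and ri: "r = prefix_of t p mod 2" "i = node_idx t (prefix_of t p)"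
  shows "node_ok A' t' z S"
proof -
  have "z mod 2 \<noteq> r \<or> node_idx t' z \<noteq> i"
    using node_idx_inj[OF t(3) z t(1) prefix_of_less[OF p(1) t(2)]] ri t by blast
  moreover have "r < 2" "z mod 2 < 2" using ri by auto
  ultimately have "A' (2 + z mod 2) (node_idx t' z) = A (2 + z mod 2) (node_idx t' z)"
    "A' (4 + z mod 2) (node_idx t' z) = A (4 + z mod 2) (node_idx t' z)"
    unfolding A' by auto
  then show ?thesis using A unfolding node_ok_def Let_def by auto
qed

definition nodes_ok :: "(nat \<Rightarrow> nat \<Rightarrow> nat) \<Rightarrow> (nat \<Rightarrow> nat set) \<Rightarrow> bool" where
  "nodes_ok A S \<longleftrightarrow> (\<forall>t \<in> {1..T}. \<forall>z < 2 ^ t. node_ok A t z (S t))"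

text \<open>The groups of resolution \<open>t + 1\<close> have been filled with the positions from \<open>n - k\<close> on.\<close>

definition node_inv :: "nat \<Rightarrow> nat \<Rightarrow> state \<Rightarrow> bool" where
  "node_inv t k s \<longleftrightarrow> arrs s 0 = a \<and> regs s 1 = t \<and> (\<forall>i\<ge>6. arrs s i = (\<lambda>_. 0)) \<and>
     nodes_ok (arrs s)
       (\<lambda>t'. if t' \<le> t then {..<n} else if t' = Suc t then {n - k..<n} else {})"

lemma node_update_correct:
  assumes "regs s 4 = p" "regs s 7 = i" "regs s 8 = v" "arrs s b i < 2 ^ w"
    "p < 2 ^ w" "i < 2 ^ w" "v < 2 ^ w" "b < 11" "b' < 11" "b \<noteq> b'" "i < 2 * n"
  shows "wp M (node_update b b') (\<lambda>s'. regs s' 0 = regs s 0 \<and> regs s' 1 = regs s 1 \<and>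
    regs s' 2 = regs s 2 \<and> arrs s' = (arrs s)(b := (arrs s b)(i := Bit_Operations.or (arrs s b i) v),
       b' := (arrs s b')(i := p))) s"
  using assms by (simp add: node_update_def word_simps take_bit_or)

lemma node_body_correct:
  assumes s: "node_inv t k s" "regs s 0 = n - 1" "regs s 2 = k" and k: "k \<le> n - 1" and t: "t < T"
  shows "wp M node_body
    (\<lambda>s'. node_inv t (Suc k) s' \<and> regs s' 0 = n - 1 \<and> regs s' 2 = k) s"
proof -
  define p where "p = n - 1 - k"
  define z where "z = prefix_of (Suc t) p"
  define r where "r = z mod 2"
  define i where "i = node_idx (Suc t) z"
  note s = s[unfolded node_inv_def]
  have p: "p < n" using n unfolding p_def by simp
  have tT: "Suc t \<le> T" "Suc t \<le> w" "t < w" using t T_le_w by auto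
  have z: "z < 2 ^ Suc t" unfolding z_def by (rule prefix_of_less[OF p tT(2)])
  have i: "i = 2 ^ t + z div 2" "i < 2 ^ Suc t"
    using node_idx_less[OF _ z] by (auto simp: i_def node_idx_def)
  have pow: "(2::nat) ^ Suc t \<le> 2 ^ T" "(2::nat) ^ Suc t \<le> 2 ^ w" "(2::nat) ^ t < 2 ^ w"
    using tT by (auto intro: power_increasing simp del: power_Suc)
  have words: "p < 2 ^ w" "z < 2 ^ w" "i < 2 ^ w" "Suc t < 2 ^ w" "t < 2 ^ w" "k < 2 ^ w" "w < 2 ^ w"
    "n - 1 < 2 ^ w" "z div 2 < 2 ^ w"
    using less_n_word[OF p] z i pow le_w_word[of t] le_w_word[of "Suc t"] le_w_word[of w]
      less_n_word[of k] tT k n N by auto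
  have c: "1 \<le> colour p" "colour p \<le> w" "colour p < 2 ^ w"
    using colour_bounds[OF p] le_w_word by auto
  define A' where "A' = (arrs s)(2 + r := (arrs s (2 + r))(i :=
      Bit_Operations.or (arrs s (2 + r) i) (2 ^ (colour p - 1))), 4 + r := (arrs s (4 + r))(i := p))"
  have A': "nodes_ok A' (\<lambda>t'. if t' \<le> t then {..<n} else if t' = Suc t then {n - Suc k..<n} else {})"
    unfolding nodes_ok_def
  proof (intro ballI allI impI)
    fix t' y assume t': "t' \<in> {1..T}" and y: "y < (2::nat) ^ t'"
    have ok: "node_ok (arrs s) t' y
        (if t' \<le> t then {..<n} else if t' = Suc t then {n - k..<n} else {})"
      using s t' y unfolding nodes_ok_def by blast
    show "node_ok A' t' y
        (if t' \<le> t then {..<n} else if t' = Suc t then {n - Suc k..<n} else {})"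
    proof (cases "t' = Suc t")
      case True
      have "node_ok A' t' y (insert p {n - k..<n})"
        by (rule node_ok_insert[OF p _ _ _ _ y _ A'_def])
           (use ok True tT k p in \<open>auto simp: p_def z_def r_def i_def\<close>)
      moreover have "insert p {n - k..<n} = {n - Suc k..<n}" using k n by (auto simp: p_def)
      ultimately show ?thesis using True by simp
    next
      case False
      have "node_ok A' t' y
          (if t' \<le> t then {..<n} else if t' = Suc t then {n - k..<n} else {})"
        by (rule node_ok_other[OF p _ tT(2) _ _ y ok A'_def])
           (use False t' in \<open>auto simp: z_def r_def i_def\<close>)
      then show ?thesis using False by (auto split: if_splits)
    qed
  qed
  have r: "r < 2" by (simp add: r_def)
  have v: "arrs s (2 + r) i < 2 ^ w"
    using s tT z unfolding nodes_ok_def node_ok_def Let_def r_def i_def by (auto simp del: power_Suc)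
  have inv: "node_inv t (Suc k) s'"
    if "regs s' 1 = t" "arrs s' = A'" for s'
    using that s A' r unfolding node_inv_def by (auto simp: A'_def)
  have z_eq: "drop_bit (w - Suc t) (g (a p)) = z" by (simp add: z_def top_bits_def)
  have update: "wp M (block [node_update b b'])
      (\<lambda>s'. node_inv t (Suc k) s' \<and> regs s' 0 = n - 1 \<and> regs s' 2 = k) s'"
    if s': "b = 2 + r" "b' = 4 + r" "regs s' 4 = p" "regs s' 7 = i" "regs s' 8 = 2 ^ (colour p - 1)"
      "arrs s' = arrs s" "regs s' 0 = n - 1" "regs s' 1 = t" "regs s' 2 = k" for s' b b'
  proof (rule wp_block_mid, rule node_update_correct[OF s'(3-5)])
    show "arrs s' b i < 2 ^ w" using v s' by simp
    show "(2::nat) ^ (colour p - 1) < 2 ^ w" using c by simp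
    show "i < 2 * n" using i pow pow_T_less by simp
    fix s'' :: state
    assume "regs s'' 0 = regs s' 0 \<and> regs s'' 1 = regs s' 1 \<and> regs s'' 2 = regs s' 2 \<and>
      arrs s'' = (arrs s')(b := (arrs s' b)(i := Bit_Operations.or (arrs s' b i) (2 ^ (colour p - 1))),
        b' := (arrs s' b')(i := p))"
    then show "wp M (block []) (\<lambda>s'. node_inv t (Suc k) s' \<and> regs s' 0 = n - 1 \<and> regs s' 2 = k) s''"
      using inv[of s''] s' by (simp add: A'_def)
  qed (use words r s' in auto)
  show "wp M node_body
    (\<lambda>s'. node_inv t (Suc k) s' \<and> regs s' 0 = n - 1 \<and> regs s' 2 = k) s"
    unfolding node_body_def
    apply (rule wp_start)
    apply (rule wp_block_Assign[where v = p])
    subgoal using s words k by (simp add: word_simps words p_def)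
    apply (rule wp_block_Load[where v = p and u = "a p"])
    subgoal using words by (simp add: word_simps words)
    subgoal by simp
    subgoal using p by simp
    subgoal using s by simp
    apply (rule wp_block_Assign[where v = z])
    subgoal using s words w tT word_a[OF p] z_eq by (simp add: word_simps words)
    apply (rule wp_block_Assign[where v = i])
    subgoal using s words w i pow
      by (simp add: word_simps words push_bit_eq_mult drop_bit_eq_div)
    apply (rule wp_block_Assign[where v = "2 ^ (colour p - 1)"])
    subgoal using s words w c word_a[OF p]
      by (simp add: word_simps words push_bit_eq_mult)
    apply (rule wp_block_Cond[where v = r])
    subgoal using s words w le_less_trans[OF mod_less_eq_dividend words(2), of 2]
      by (simp add: word_simps words r_def and_one_eq)
    subgoal by (rule update) (use s r in auto)
    subgoal by (rule update) (use s r in auto)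
    done
qed

lemma nodes_correct:
  assumes s: "arrs s 0 = a" "\<And>i. i \<ge> 2 \<Longrightarrow> arrs s i = (\<lambda>_. 0)" "regs s 0 = n - 1"
  shows "runs M (levels (sweep node_body)) s (T * (n * (cost node_body + 3) + 3 + 2) + 2)
    (\<lambda>s'. arrs s' 0 = a \<and> (\<forall>i\<ge>6. arrs s' i = (\<lambda>_. 0)) \<and> nodes_ok (arrs s') (\<lambda>_. {..<n}) \<and>
      regs s' 0 = n - 1 \<and> regs s' 1 = T)"
proof -
  define J where "J t s' \<longleftrightarrow> arrs s' 0 = a \<and> (\<forall>i\<ge>6. arrs s' i = (\<lambda>_. 0)) \<and>
    nodes_ok (arrs s') (\<lambda>t'. if t' \<le> t then {..<n} else {})" for t and s' :: state
  have level: "runs M (sweep node_body) s ((n - 1 + 1) * (cost node_body + 3) + 3)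
      (\<lambda>s'. regs s' 0 = n - 1 \<and> regs s' 1 = t \<and> J (Suc t) (s'\<lparr>regs := (regs s')(1 := Suc t)\<rparr>))"
    if t: "t < T" and s: "J t s" "regs s 0 = n - 1" "regs s 1 = t" for t s
  proof (rule runs_mono[OF runs_sweep[where J = "node_inv t" and N = "n - 1" and b = "cost node_body"]])
    have "(\<lambda>t'. if t' \<le> t then {..<n} else if t' = Suc t then {n - 0..<n} else {}) =
        (\<lambda>t'. if t' \<le> t then {..<n} else {})" by (simp add: fun_eq_iff)
    then show "node_inv t 0 s" using s unfolding node_inv_def J_def by simp
    show "runs M node_body s (cost node_body)
        (\<lambda>s'. node_inv t (Suc k) s' \<and> regs s' 0 = n - 1 \<and> regs s' 2 = k)"
      if "k \<le> n - 1" "node_inv t k s" "regs s 0 = n - 1" "regs s 2 = k" for k s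
      by (rule runs_wp, rule node_body_correct) (use that t in auto)
    fix s' assume s': "node_inv t (Suc (n - 1)) s' \<and> regs s' 0 = n - 1"
    have "(\<lambda>t'. if t' \<le> t then {..<n} else if t' = Suc t then {n - Suc (n - 1)..<n} else {}) =
        (\<lambda>t'. if t' \<le> Suc t then {..<n} else {})" using n by (auto simp: fun_eq_iff)
    then show "regs s' 0 = n - 1 \<and> regs s' 1 = t \<and> J (Suc t) (s'\<lparr>regs := (regs s')(1 := Suc t)\<rparr>)"
      using s' unfolding node_inv_def J_def by simp
  qed (use w N s in \<open>auto simp: node_inv_def\<close>)
  show ?thesis
  proof (rule runs_mono[OF runs_levels[where J = J and N = "n - 1" and T = T]])
    \<comment> \<open>Zeroed memory already describes empty groups, so no initialisation pass is
      needed.\<close>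
    have "nodes_ok (arrs s) (\<lambda>t'. if t' \<le> 0 then {..<n} else {})"
      using s(2) by (auto simp: nodes_ok_def node_ok_def)
    then show "J 0 (s\<lparr>regs := (regs s)(1 := 0)\<rparr>)" using s by (simp add: J_def)
    show "T * ((n - 1 + 1) * (cost node_body + 3) + 3 + 2) + 2 \<le>
      T * (n * (cost node_body + 3) + 3 + 2) + 2" using n by simp
    fix s' assume "J T s' \<and> regs s' 0 = n - 1 \<and> regs s' 1 = T"
    then show "arrs s' 0 = a \<and> (\<forall>i\<ge>6. arrs s' i = (\<lambda>_. 0)) \<and> nodes_ok (arrs s') (\<lambda>_. {..<n}) \<and>
      regs s' 0 = n - 1 \<and> regs s' 1 = T"
      by (auto simp: J_def nodes_ok_def)
  qed (use w N s level T_gt' in auto)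
qed

end

section \<open>Linking the elements of equal hash value\<close>

text \<open>Arrays of fields of \<open>T\<close> bits, of which \<open>e\<close> are packed into a word.\<close>

definition field :: "nat \<Rightarrow> nat \<Rightarrow> (nat \<Rightarrow> nat) \<Rightarrow> nat \<Rightarrow> nat" where
  "field T e F k = take_bit T (drop_bit (k mod e * T) (F (k div e)))"

text \<open>Flipping the bits in which the old and the new value differ replaces the field without
  clearing it first. The difference fits into \<open>T\<close> bits, so neighbouring fields are
  untouched.\<close>

lemma field_update:
  assumes "e > 0" "p < 2 ^ T"
    and F': "F' = F(k div e :=
      Bit_Operations.xor (F (k div e)) (push_bit (k mod e * T) (Bit_Operations.xor (field T e F k) p)))"
  shows "field T e F' k' = (if k' = k then p else field T e F k')"
proof (cases "k' div e = k div e")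
  case False
  then show ?thesis by (auto simp: field_def F')
next
  case div: True
  have p: "bit p i \<Longrightarrow> i < T" for i
    using assms(2) by (metis bit_take_bit_iff take_bit_nat_eq_self_iff)
  show ?thesis
  proof (cases "k' mod e = k mod e")
    case True
    then have "k' = k" using div by (metis div_mult_mod_eq)
    moreover have "field T e F' k = p"
      by (rule bit_eqI)
         (use p in \<open>auto simp: F' field_def bit_take_bit_iff bit_drop_bit_eq bit_xor_iff bit_push_bit_iff\<close>)
    ultimately show ?thesis by simp
  next
    case False
    then have ne: "k' \<noteq> k" by auto
    \<comment> \<open>Offsets of different fields of a word are at least \<open>T\<close>
      apart.\<close>
    have "\<not> bit (push_bit (k mod e * T) (Bit_Operations.xor (field T e F k) p)) (k' mod e * T + i)"
      if "i < T" for i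
    proof (cases "k' mod e < k mod e")
      case True
      then have "Suc (k' mod e) * T \<le> k mod e * T" by (intro mult_le_mono1) simp
      then show ?thesis using that by (simp add: bit_xor_iff bit_push_bit_iff)
    next
      case False
      then have "Suc (k mod e) * T \<le> k' mod e * T"
        using \<open>k' mod e \<noteq> k mod e\<close> by (intro mult_le_mono1) simp
      then have "k' mod e * T + i - k mod e * T \<ge> T" by simp
      then show ?thesis
        by (auto simp: bit_push_bit_iff bit_xor_iff field_def bit_take_bit_iff dest!: p)
    qed
    then have "field T e F' k' = field T e F k'"
      using div by (intro bit_eqI) (auto simp: F' field_def bit_take_bit_iff bit_drop_bit_eq bit_xor_iff)
    then show ?thesis using ne by simp
  qed
qed

text \<open>When \<open>T = w\<close>, the modulus \<open>2 ^ T\<close> is truncated to 0, and \<open>v mod 0 = v\<close> is again the value of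
  the lowest \<open>T\<close> bits.\<close>

definition field_read :: com where
  "field_read = block
    [Load 9 8 (Binop Div (Reg 6) (Reg 12)),
     Assign 13 (Binop Mul (Binop Mod (Reg 6) (Reg 12)) (Reg 1)),
     Assign 10 (Binop Mod (Binop Shr (Reg 9) (Reg 13)) (Binop Shl (Lit 1) (Reg 1)))]"

text \<open>For the element at position \<open>p = n - 1 - k\<close>, array 6 receives the position of the next element
  with the same hash value. Array 7 marks in bit \<open>w - 1 - j\<close> whether \<open>p + j\<close> has that hash value as
  well (for \<open>j < w\<close>). Array 8 is packed and has the first position of every hash value. Array 9
  saves its field \<open>p mod w\<close>. With 0 standing for a missing position, no case distinction is needed
  for array 7, as \<open>0\<close> is the last cell to be filled.\<close>

definition link_body :: com where
  "link_body = block
    [Assign 4 (Binop Sub (Reg 0) (Reg 2)),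
     Load 5 0 (Reg 4),
     Assign 6 (Binop Sub (HVal (Reg 5)) (Lit 1)),
     Assign 12 (Binop Div Width (Reg 1)),
     field_read,
     Store 6 (Reg 4) (Reg 10),
     Load 11 7 (Reg 10),
     Store 7 (Reg 4) (Binop Or (Binop Shl (Lit 1) (Binop Sub Width (Lit 1)))
                               (Binop Shr (Reg 11) (Binop Sub (Reg 10) (Reg 4)))),
     Store 8 (Binop Div (Reg 6) (Reg 12))
       (Binop Xor (Reg 9) (Binop Shl (Binop Xor (Reg 10) (Reg 4)) (Reg 13))),
     Assign 6 (Binop Mod (Reg 4) Width),
     field_read,
     Store 9 (Reg 4) (Reg 10)]"

section \<open>Packing \<open>w\<close> fields of \<open>T\<close> bits\<close>

context preprocessing
begin

definition e :: nat where
  "e = w div T"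

lemma e_pos: "e > 0"
  using T_le_w T_pos by (simp add: e_def div_greater_zero_iff)

lemma field_end: "k mod e * T + T \<le> w"
proof -
  have "Suc (k mod e) * T \<le> e * T" using e_pos by (intro mult_le_mono1) (simp add: Suc_leI)
  also have "\<dots> \<le> w" by (simp add: e_def)
  finally show ?thesis by simp
qed

text \<open>From \<open>w < T * (e + 1) \<le> 2 * T * e\<close> the table takes at most
  \<open>2 * T\<close> cells, and \<open>T \<le> n\<close> because
  \<open>T - 1 < 2 ^ (T - 1) < n\<close>.\<close>

lemma field_cell: assumes "k < w" shows "k div e < 2 * n"
proof -
  have "w < T * Suc e" using T_pos by (simp add: e_def dividend_less_times_div)
  also have "\<dots> \<le> T * (2 * e)" using e_pos by (intro mult_le_mono2) simp
  finally have "k < 2 * T * e" using assms by (simp add: ac_simps)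
  then have "k div e < 2 * T" by (rule less_mult_imp_div_less)
  also have "T \<le> n"
  proof -
    have "T - 1 < 2 ^ (T - 1)" by (rule less_exp)
    also have "\<dots> < n" using T_gt[of "T - 1"] T_pos by simp
    finally show ?thesis by simp
  qed
  finally show ?thesis by simp
qed

lemma mod_pow_word:
  fixes v :: nat
  assumes "v < 2 ^ w"
  shows "v mod take_bit w (2 ^ T) = take_bit T v"
proof (cases "T = w")
  case True
  have "take_bit w (2 ^ w :: nat) = 0" by (simp add: take_bit_eq_mod)
  then show ?thesis using True assms by (simp add: take_bit_nat_eq_self)
next
  case False
  then have "take_bit w (2 ^ T :: nat) = 2 ^ T" using T_le_w by (simp add: take_bit_nat_eq_self)
  then show ?thesis by (simp add: take_bit_eq_mod)
qed

lemma field_read_correct: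
  assumes "r 6 = k" "k < w" "r 12 = e" "r 1 = T" "A 8 (k div e) < 2 ^ w"
    and Q: "wp M (block cs) Q \<lparr>regs = r(9 := A 8 (k div e), 13 := k mod e * T,
      10 := field T e (A 8) k), arrs = A, outp = os\<rparr>"
  shows "wp M (block (field_read # cs)) Q \<lparr>regs = r, arrs = A, outp = os\<rparr>"
proof -
  have "e \<le> w" by (simp add: e_def)
  moreover have "k div e \<le> w" "k mod e \<le> w"
    using assms(2) by (auto intro: order_trans[OF div_le_dividend] order_trans[OF mod_less_eq_dividend])
  moreover have "k mod e * T \<le> w" using field_end[of k] by simp
  ultimately have words: "k < 2 ^ w" "e < 2 ^ w" "T < 2 ^ w" "k div e < 2 ^ w" "k mod e < 2 ^ w"
    "k mod e * T < 2 ^ w"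
    using assms(2) T_le_w by (auto intro!: le_w_word)
  let ?v = "drop_bit (k mod e * T) (A 8 (k div e))"
  have v: "?v < 2 ^ w" using assms(5) by (metis div_le_dividend drop_bit_eq_div le_less_trans)
  have fld: "take_bit w (?v mod take_bit w (push_bit T 1)) = take_bit T ?v"
    unfolding push_bit_eq_mult mult_1 mod_pow_word[OF v]
    using v by (metis le_less_trans take_bit_nat_less_eq_self take_bit_nat_eq_self)
  show ?thesis
    unfolding field_read_def
    apply (rule wp_block_block, simp only: append.simps)
    apply (rule wp_block_Load[where v = "k div e" and u = "A 8 (k div e)"])
    subgoal using assms by (simp add: words word_simps)
    subgoal by simp
    subgoal using field_cell assms by simp
    subgoal by simp
    apply (rule wp_block_Assign[where v = "k mod e * T"])
    subgoal using assms by (simp add: words word_simps)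
    apply (rule wp_block_Assign[where v = "field T e (A 8) k"])
    subgoal using assms v w fld by (simp add: words word_simps field_def)
    using Q by simp
qed

end


section \<open>Next occurrences of a hash value, and masks\<close>

context sorted_input
begin

text \<open>The default 0 is unambiguous when the search starts at a positive position, as for
  links. From position 0 it is ambiguous, and the queries rely on the result only when an occurrence
  is known to exist.\<close>

definition next_pos :: "nat \<Rightarrow> nat \<Rightarrow> nat" where
  "next_pos p y =
     (if \<exists>q. p \<le> q \<and> q < n \<and> colour q = y then LEAST q. p \<le> q \<and> q < n \<and> colour q = y else 0)"

lemma next_pos_eqI:
  "p \<le> q \<Longrightarrow> q < n \<Longrightarrow> colour q = y \<Longrightarrow> (\<And>r. p \<le> r \<Longrightarrow> r < q \<Longrightarrow> colour r \<noteq> y) \<Longrightarrow>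
   next_pos p y = q"
  unfolding next_pos_def by (auto intro!: Least_equality) (meson not_less)

lemma next_pos_here: "p < n \<Longrightarrow> next_pos p (colour p) = p"
  by (rule next_pos_eqI) auto

text \<open>Moving the start of the search left by one place changes the table of next positions
  only at the hash value of the new place: one field update per round suffices.\<close>

lemma next_pos_Suc: "colour p \<noteq> y \<Longrightarrow> next_pos p y = next_pos (Suc p) y"
proof -
  assume "colour p \<noteq> y"
  then have "p \<le> q \<and> q < n \<and> colour q = y \<longleftrightarrow> Suc p \<le> q \<and> q < n \<and> colour q = y" for q
    by (metis Suc_leD Suc_leI le_neq_implies_less)
  then show ?thesis unfolding next_pos_def by (simp only:)
qed

lemma next_pos_props:
  assumes "p \<le> q" "q < n" "colour q = y"
  shows "p \<le> next_pos p y" "next_pos p y \<le> q" "colour (next_pos p y) = y"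
    "p \<le> r \<Longrightarrow> r < next_pos p y \<Longrightarrow> colour r \<noteq> y"
proof -
  let ?P = "\<lambda>q. p \<le> q \<and> q < n \<and> colour q = y"
  have eq: "next_pos p y = (LEAST q. ?P q)" using assms unfolding next_pos_def by auto
  have "?P (LEAST q. ?P q)" by (rule LeastI[of ?P q]) (use assms in auto)
  moreover have le: "(LEAST q. ?P q) \<le> q" by (rule Least_le) (use assms in auto)
  ultimately show "p \<le> next_pos p y" "next_pos p y \<le> q" "colour (next_pos p y) = y"
    unfolding eq by auto
  show "colour r \<noteq> y" if "p \<le> r" "r < next_pos p y"
    using not_less_Least[of r ?P] that le assms(2) unfolding eq by auto
qed

lemma next_pos_less: "next_pos p y < n"
proof (cases "\<exists>q. p \<le> q \<and> q < n \<and> colour q = y")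
  case True
  then show ?thesis using next_pos_props(2) by (meson le_less_trans)
next
  case False
  then have "next_pos p y = 0" unfolding next_pos_def by (rule if_not_P)
  then show ?thesis using n by simp
qed

lemma next_pos_eq_0: "next_pos (Suc p) y = 0 \<Longrightarrow> p < q \<Longrightarrow> q < n \<Longrightarrow> colour q \<noteq> y"
  using next_pos_props(1)[of "Suc p" q y] by auto

lemma next_pos_neq_0:
  assumes "next_pos p y \<noteq> 0"
  obtains q where "p \<le> q" "q < n" "colour q = y"
  using assms that unfolding next_pos_def by (metis (no_types, lifting))

text \<open>Storing the offsets from the top bit down serves two ends: moving to an earlier position
  is a right shift, and in a query the positions from \<open>l\<close> on can be shifted out, so
  that counting trailing zeros searches backwards from \<open>l - 1\<close>.\<close>

definition mask_ok :: "nat \<Rightarrow> nat \<Rightarrow> bool" where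
  "mask_ok v p \<longleftrightarrow> v < 2 ^ w \<and>
     (\<forall>i<w. bit v i \<longleftrightarrow> p + (w - 1 - i) < n \<and> colour (p + (w - 1 - i)) = colour p)"

text \<open>The mask of \<open>p\<close> is the top bit for \<open>p\<close> itself together with
  the mask of the next occurrence, shifted by the distance. If there is no next occurrence, the
  difference wraps around, but then the shifted word is 0.\<close>

lemma mask_ok_step:
  assumes p: "p < n"
    and v: "next_pos (Suc p) (colour p) \<noteq> 0 \<Longrightarrow> mask_ok v (next_pos (Suc p) (colour p))"
      "next_pos (Suc p) (colour p) = 0 \<Longrightarrow> v = 0"
  shows "mask_ok (Bit_Operations.or (2 ^ (w - 1))
    (drop_bit (take_bit w (next_pos (Suc p) (colour p) + (2 ^ w - p))) v)) p"
proof -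
  let ?q = "next_pos (Suc p) (colour p)"
  let ?v = "drop_bit (take_bit w (?q + (2 ^ w - p))) v"
  have vw: "v < 2 ^ w" using v by (cases "?q = 0") (auto simp: mask_ok_def)
  then have "?v < 2 ^ w" by (metis div_le_dividend drop_bit_eq_div le_less_trans)
  moreover have "(2::nat) ^ (w - 1) < 2 ^ w" using w by simp
  ultimately have less: "Bit_Operations.or (2 ^ (w - 1)) ?v < 2 ^ w"
    by (metis take_bit_nat_eq_self_iff take_bit_or)
  have bits: "bit (Bit_Operations.or (2 ^ (w - 1)) ?v) i \<longleftrightarrow>
      p + (w - 1 - i) < n \<and> colour (p + (w - 1 - i)) = colour p" if i: "i < w" for i
  proof (cases "i = w - 1")
    case True
    then show ?thesis using p by (simp add: bit_or_iff bit_exp_iff)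
  next
    case False
    then have bit_i: "bit (Bit_Operations.or (2 ^ (w - 1)) ?v) i \<longleftrightarrow> bit ?v i"
      by (auto simp: bit_or_iff bit_exp_iff)
    show ?thesis
    proof (cases "?q = 0")
      case True
      have "\<not> bit ?v i" using v(2)[OF True] by simp
      moreover have "p + (w - 1 - i) < n \<Longrightarrow> colour (p + (w - 1 - i)) \<noteq> colour p"
        using next_pos_eq_0[OF True] False i by simp
      ultimately show ?thesis using bit_i by blast
    next
      case q0: False
      obtain q where "Suc p \<le> q" "q < n" "colour q = colour p" by (rule next_pos_neq_0[OF q0])
      note q = next_pos_props[OF this]
      have "p \<le> ?q" using q(1) by simp
      then have shift: "?v = drop_bit (?q - p) v"
        using take_bit_sub(1)[of p ?q w] less_n_word[OF next_pos_less[of "Suc p" "colour p"]]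
        by simp
      show ?thesis
      proof (cases "?q - p + i < w")
        case True
        then have "bit ?v i \<longleftrightarrow> ?q + (w - 1 - (?q - p + i)) < n \<and>
            colour (?q + (w - 1 - (?q - p + i))) = colour ?q"
          using v(1)[OF q0] unfolding shift by (simp add: bit_drop_bit_eq mask_ok_def)
        moreover have "?q + (w - 1 - (?q - p + i)) = p + (w - 1 - i)" using True q(1) by simp
        ultimately show ?thesis by (simp only: bit_i q(3))
      next
        \<comment> \<open>The next occurrence is too far away for bit \<open>i\<close>: the position
          in question lies strictly between the two occurrences.\<close>
        case big: False
        have "\<not> bit ?v i"
          using big vw unfolding shift bit_drop_bit_eq
          by (metis bit_take_bit_iff comp_apply take_bit_nat_eq_self)
        moreover have "colour (p + (w - 1 - i)) \<noteq> colour p"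
          by (rule q(4)) (use big False i in auto)
        ultimately show ?thesis using bit_i by blast
      qed
    qed
  qed
  show ?thesis unfolding mask_ok_def using less bits by blast
qed

text \<open>\<open>A\<close> is the memory before the sweep, whose group arrays 2 to 5 must survive.
  Array 8 describes the suffix from \<open>n - k\<close> on, so reading it before its update gives
  the link of position \<open>n - k - 1\<close>.\<close>

definition link_inv :: "(nat \<Rightarrow> nat \<Rightarrow> nat) \<Rightarrow> nat \<Rightarrow> state \<Rightarrow> bool" where
  "link_inv A k s \<longleftrightarrow> arrs s 0 = a \<and> regs s 1 = T \<and> (\<forall>i\<in>{2..5}. arrs s i = A i) \<and>
     (\<forall>p\<in>{n - k..<n}. arrs s 6 p = next_pos (Suc p) (colour p) \<and> mask_ok (arrs s 7 p) p \<and>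
        arrs s 9 p = next_pos p (Suc (p mod w))) \<and>
     (\<forall>p<n - k. arrs s 7 p = 0) \<and>
     (\<forall>i. arrs s 8 i < 2 ^ w) \<and> (\<forall>j<w. field T e (arrs s 8) j = next_pos (n - k) (Suc j))"

lemma link_body_correct:
  assumes s: "link_inv A k s" "regs s 0 = n - 1" "regs s 2 = k" and k: "k \<le> n - 1"
  shows "wp M link_body
    (\<lambda>s'. link_inv A (Suc k) s' \<and> regs s' 0 = n - 1 \<and> regs s' 2 = k) s"
proof -
  define p where "p = n - 1 - k"
  define c where "c = colour p - 1"
  define q where "q = next_pos (Suc p) (colour p)"
  note s = s[unfolded link_inv_def]
  have p: "p < n" "n - k = Suc p" "n - Suc k = p" using n k unfolding p_def by auto
  have c: "c < w" "Suc c = colour p" using colour_bounds[OF p(1)] unfolding c_def by auto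
  have q: "q < n" unfolding q_def by (rule next_pos_less)
  have q7: "mask_ok (arrs s 7 q) q" if "q \<noteq> 0"
  proof -
    obtain q' where "Suc p \<le> q'" "q' < n" "colour q' = colour p"
      using next_pos_neq_0 \<open>q \<noteq> 0\<close> unfolding q_def by metis
    then have "Suc p \<le> q" unfolding q_def by (rule next_pos_props)
    then show ?thesis using s q p by simp
  qed
  have q70: "arrs s 7 q = 0" if "q = 0" using s p that by simp
  \<comment> \<open>The shift amount stays in truncated form since \<open>q\<close> may be
    0.\<close>
  define m where "m = Bit_Operations.or (2 ^ (w - 1)) (drop_bit (take_bit w (q + (2 ^ w - p))) (arrs s 7 q))"
  have m: "mask_ok m p" unfolding m_def q_def
    by (rule mask_ok_step[OF p(1)]) (use q7 q70 in \<open>auto simp: q_def\<close>)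
  define F where "F = (arrs s 8)(c div e := Bit_Operations.xor (arrs s 8 (c div e))
    (push_bit (c mod e * T) (Bit_Operations.xor q p)))"
  have fld: "field T e (arrs s 8) c = q" using s c p by (simp add: q_def)
  have pT: "p < 2 ^ T" "q < 2 ^ T" using p q n_le_T by auto
  have F: "field T e F j = next_pos p (Suc j)" if "j < w" for j
  proof -
    have "field T e F j = (if j = c then p else field T e (arrs s 8) j)"
      by (rule field_update[OF e_pos pT(1)]) (simp add: F_def fld)
    moreover have "next_pos p (Suc j) = next_pos (Suc p) (Suc j)" if "j \<noteq> c"
      by (rule next_pos_Suc) (use that c in auto)
    ultimately show ?thesis using s c that next_pos_here[OF p(1)] p(2) by auto
  qed
  have push: "push_bit (c mod e * T) x < 2 ^ w" if "x < 2 ^ T" for x :: nat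
  proof -
    have "push_bit (c mod e * T) x < 2 ^ T * 2 ^ (c mod e * T)"
      using that by (simp add: push_bit_eq_mult)
    also have "\<dots> \<le> 2 ^ w" using field_end[of c] by (simp flip: power_add)
    finally show ?thesis .
  qed
  have "Bit_Operations.xor q p < 2 ^ T" using pT by (metis take_bit_nat_eq_self_iff take_bit_xor)
  note xw = push[OF this]
  have Fw: "F i < 2 ^ w" for i
    using s xw unfolding F_def by (auto) (metis take_bit_nat_eq_self_iff take_bit_xor)
  have Fc: "F (c div e) < 2 ^ w" by (rule Fw)
  have ce: "c div e < 2 ^ w" "e < 2 ^ w" "T < 2 ^ w" "p mod w < w" "c mod e * T < 2 ^ w" "p mod w < 2 ^ w"
    using c le_w_word[of "c div e"] le_w_word[of e] le_w_word[of T] T_le_w w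
      order_trans[OF div_le_dividend[of c e], of w] field_end[of c] le_w_word[of "c mod e * T"]
      le_w_word[of "p mod w"] less_imp_le[OF mod_less_divisor[of w p]]
    by (auto simp: e_def)
  have words: "p < 2 ^ w" "q < 2 ^ w" "k < 2 ^ w" "w < 2 ^ w" "c < 2 ^ w" "colour p < 2 ^ w" "n - 1 < 2 ^ w"
    "(2::nat) ^ (w - 1) < 2 ^ w" "m < 2 ^ w"
    "n - Suc 0 < 2 ^ w"
    using less_n_word[OF p(1)] less_n_word[OF q] less_n_word[of k] k n N(1) c le_w_word[of c]
      le_w_word[of "colour p"] w m by (auto simp: mask_ok_def)
  have x8: "arrs s 8 (c div e) < 2 ^ w" using s by blast
  have dw: "drop_bit x v < 2 ^ w" if "v < 2 ^ w" for x v :: nat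
    using that by (metis div_le_dividend drop_bit_eq_div le_less_trans)
  have s7w: "arrs s 7 q < 2 ^ w" using q7 q70 by (cases "q = 0") (auto simp: mask_ok_def)
  have mask_store: "exp_val M (Binop Or (Binop Shl (Lit 1) (Binop Sub Width (Lit 1)))
      (Binop Shr (Reg 11) (Binop Sub (Reg 10) (Reg 4)))) r = m"
    if r: "r 11 = arrs s 7 q" "r 10 = q" "r 4 = p" for r
  proof -
    have one: "take_bit w (1 :: nat) = 1" using w by simp
    have "take_bit w (w + (2 ^ w - 1)) = w - 1" using take_bit_sub(1)[OF w words(4)] .
    note eqs = this one push_bit_eq_mult mult_1 words(1,2,4,8)[THEN take_bit_nat_eq_self]
      s7w[THEN take_bit_nat_eq_self] dw[OF s7w, THEN take_bit_nat_eq_self]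
    have "exp_val M (Binop Or (Binop Shl (Lit 1) (Binop Sub Width (Lit 1)))
        (Binop Shr (Reg 11) (Binop Sub (Reg 10) (Reg 4)))) r = take_bit w m"
      by (simp only: exp_val.simps binop_val.simps r M_simps eqs m_def)
    also have "\<dots> = m" by (rule take_bit_nat_eq_self[OF words(9)])
    finally show ?thesis .
  qed
  have store: "exp_val M (Binop Xor (Reg 9) (Binop Shl (Binop Xor (Reg 10) (Reg 4)) (Reg 13))) r =
      F (c div e)"
    if r: "r 9 = arrs s 8 (c div e)" "r 10 = q" "r 4 = p" "r 13 = c mod e * T" for r
  proof -
    have "Bit_Operations.xor q p < 2 ^ w"
      using words(1,2) by (metis take_bit_nat_eq_self_iff take_bit_xor)
    note eqs = this words(1,2) x8 xw ce(5)
    have "exp_val M (Binop Xor (Reg 9) (Binop Shl (Binop Xor (Reg 10) (Reg 4)) (Reg 13))) r =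
        take_bit w (Bit_Operations.xor (arrs s 8 (c div e))
          (push_bit (c mod e * T) (Bit_Operations.xor q p)))"
      by (simp only: exp_val.simps binop_val.simps r M_simps eqs[THEN take_bit_nat_eq_self])
    also have "\<dots> = take_bit w (F (c div e))" by (simp only: F_def fun_upd_same)
    also have "\<dots> = F (c div e)" by (rule take_bit_nat_eq_self[OF Fc])
    finally show ?thesis .
  qed
  have Fupd: "(arrs s 8)(c div e := F (c div e)) = F" by (simp add: F_def)
  have range: "{n - Suc k..<n} = insert p {n - k..<n}" using p by auto
  have final: "link_inv A (Suc k) s'"
    if s': "regs s' 1 = T"
      "arrs s' = (arrs s)(6 := (arrs s 6)(p := q), 7 := (arrs s 7)(p := m), 8 := F,
        9 := (arrs s 9)(p := next_pos p (Suc (p mod w))))" for s'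
  proof -
    have "\<forall>r\<in>{n - Suc k..<n}. arrs s' 6 r = next_pos (Suc r) (colour r) \<and>
        mask_ok (arrs s' 7 r) r \<and> arrs s' 9 r = next_pos r (Suc (r mod w))"
      unfolding range
    proof
      fix r assume "r \<in> insert p {n - k..<n}"
      moreover have "r \<noteq> p \<Longrightarrow> r \<in> {n - k..<n} \<Longrightarrow> arrs s 6 r = next_pos (Suc r) (colour r) \<and>
        mask_ok (arrs s 7 r) r \<and> arrs s 9 r = next_pos r (Suc (r mod w))"
        using s by blast
      ultimately show "arrs s' 6 r = next_pos (Suc r) (colour r) \<and>
        mask_ok (arrs s' 7 r) r \<and> arrs s' 9 r = next_pos r (Suc (r mod w))"
        using m by (cases "r = p") (simp_all add: s' q_def)
    qed
    moreover have "\<forall>r<n - Suc k. arrs s' 7 r = 0" using s p by (simp add: s')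
    moreover have "\<forall>j<w. field T e (arrs s' 8) j = next_pos (n - Suc k) (Suc j)"
      using F p by (simp add: s')
    moreover have "\<forall>i\<in>{2..5}. arrs s' i = A i" "arrs s' 0 = a" using s by (simp_all add: s')
    moreover have "\<forall>i. arrs s' 8 i < 2 ^ w" using Fw by (simp add: s')
    ultimately show ?thesis using s'(1) unfolding link_inv_def by blast
  qed
  show ?thesis
    unfolding link_body_def
    apply (rule wp_start)
    apply (rule wp_block_Assign[where v = p])
    subgoal using s k by (simp add: word_simps words p_def)
    apply (rule wp_block_Load[where v = p and u = "a p"])
    subgoal by (simp add: word_simps words)
    subgoal by simp
    subgoal using p by simp
    subgoal using s by simp
    apply (rule wp_block_Assign[where v = c])
    subgoal using w c word_a[OF p(1)] colour_bounds[OF p(1)] by (simp add: word_simps words c_def)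
    apply (rule wp_block_Assign[where v = e])
    subgoal using s by (simp add: word_simps words ce flip: e_def)
    apply (rule field_read_correct[where k = c])
    subgoal by simp
    subgoal by (rule c)
    subgoal by simp
    subgoal using s by simp
    subgoal using x8 by simp
    apply (rule wp_block_Store[where v = p and u = q])
    subgoal by (simp add: word_simps words)
    subgoal by simp
    subgoal using p by simp
    subgoal using fld by (simp add: word_simps words)
    apply (rule wp_block_Load[where v = q and u = "arrs s 7 q"])
    subgoal using fld by (simp add: word_simps words)
    subgoal by simp
    subgoal using q by simp
    subgoal by simp
    apply (rule wp_block_Store[where v = p and u = m])
    subgoal by (simp add: word_simps words)
    subgoal by simp
    subgoal using p by simp
    subgoal by (rule mask_store) (simp_all add: fld)
    apply (rule wp_block_Store[where v = "c div e" and u = "F (c div e)"])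
    subgoal using fld by (simp add: word_simps words ce)
    subgoal by simp
    subgoal using field_cell[OF c(1)] by simp
    subgoal by (rule store) (simp_all add: fld)
    apply (rule wp_block_Assign[where v = "p mod w"])
    subgoal using ce by (simp add: word_simps words ce)
    \<comment> \<open>This second read comes after the update, so the saved position may be
      \<open>p\<close> itself.\<close>
    apply (rule field_read_correct[where k = "p mod w"])
    subgoal by simp
    subgoal by (rule ce)
    subgoal by simp
    subgoal using s by simp
    subgoal using Fw[of "p mod w div e"] by (simp add: F_def)
    apply (rule wp_block_Store[where v = p and u = "next_pos p (Suc (p mod w))"])
    subgoal by (simp add: word_simps words)
    subgoal by simp
    subgoal using p by simp
    subgoal using F[OF ce(4)] less_n_word[OF next_pos_less] by (simp add: word_simps words F_def)
    apply (rule wp_block_Nil)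
    apply (intro conjI)
    subgoal by (rule final) (use s Fupd in simp_all)
    subgoal using s by simp
    subgoal using s by simp
    done
qed

end

section \<open>Queries\<close>

definition node_addr :: exp where
  "node_addr = Binop Add (Binop Shl (Lit 1) (Binop Sub (Reg 0) (Lit 1))) (Binop Shr (Reg 1) (Lit 1))"

definition parity_load :: "nat \<Rightarrow> nat \<Rightarrow> com" where
  "parity_load i b = Cond (Binop And (Reg 1) (Lit 1)) (Load i (Suc b) (Reg 7)) (Load i b (Reg 7))"

definition word_query :: com where
  "word_query = block [Assign 7 node_addr, parity_load 9 2, Emit (Reg 9)]"

text \<open>The first occurrence of the hash value \<open>y\<close> after the left end \<open>l\<close> of a group is searched from
  the greatest position \<open>b \<le> l\<close> at which the search result was saved in array 9, i.e.
  \<open>b mod w = y - 1\<close>, or from \<open>b = 0\<close> if there is none. If it leads to a position \<open>p < l\<close>, then the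
  last occurrence before \<open>l\<close> is found in the mask of \<open>p\<close>, since \<open>l - p < w\<close>.\<close>

definition locate :: com where
  "locate = block
    [parity_load 4 4,
     Assign 3 (Reg 1),
     Load 1 10 (Lit 0),
     Assign 6 (Binop Sub (Reg 2) (Lit 1)),
     Assign 12 (Binop Div Width (Reg 1)),
     field_read,
     Cond (Binop Less (Reg 4) (Reg 6)) Skip
       (Load 10 9 (Binop Sub (Reg 4) (Binop Mod (Binop Sub (Reg 4) (Reg 6)) Width))),
     Cond (Binop Less (Reg 10) (Reg 4))
       (block
         [Load 11 7 (Reg 10),
          Assign 11 (Unop Ctz (Binop Shr (Reg 11) (Binop Sub Width (Binop Sub (Reg 4) (Reg 10))))),
          Load 10 6 (Binop Sub (Binop Sub (Reg 4) (Lit 1)) (Reg 11))])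
       Skip]"

definition walk_body :: com where
  "walk_body = block
    [Load 11 0 (Reg 10),
     Emit (Reg 11),
     Load 10 6 (Reg 10),
     Load 11 0 (Reg 10),
     Assign 5 (Binop And (Binop Less (Lit 0) (Reg 10))
       (Binop Eq (Binop Shr (GVal (Reg 11)) (Binop Sub Width (Reg 0))) (Reg 3)))]"

definition list_query_init :: com where
  "list_query_init = block [Assign 7 node_addr, parity_load 9 2]"

definition list_query :: com where
  "list_query = Seq list_query_init
     (Cond (Binop And (Binop Shr (Reg 9) (Binop Sub (Reg 2) (Lit 1))) (Lit 1))
       (Seq locate (Seq (Assign 5 (Lit 1)) (While (Reg 5) walk_body)))
       Skip)"

context sorted_input
begin

lemma node_addr_val:
  assumes "r 0 = t" "r 1 = z" "1 \<le> t" "t \<le> T" "z < 2 ^ t"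
  shows "exp_val M node_addr r = node_idx t z" "node_idx t z < 2 * n" "z < 2 ^ w"
    "node_idx t z < 2 ^ w"
proof -
  have i: "node_idx t z < 2 ^ t" using node_idx_less assms by blast
  have pow: "(2::nat) ^ t \<le> 2 ^ T" "(2::nat) ^ t \<le> 2 ^ w"
    using assms T_le_w by (auto intro: power_increasing)
  then show "node_idx t z < 2 * n" "z < 2 ^ w" "node_idx t z < 2 ^ w"
    using i pow_T_less assms(5) by linarith+
  have iw: "node_idx t z < 2 ^ w" using i pow(2) by linarith
  have words: "t < 2 ^ w" "z < 2 ^ w" "z div 2 < 2 ^ w" "(2::nat) ^ (t - Suc 0) < 2 ^ w"
    "2 ^ (t - Suc 0) + z div 2 < 2 ^ w"
  proof -
    show "t < 2 ^ w" using le_w_word[of t] T_le_w assms by simp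
    show "z < 2 ^ w" using assms(5) pow(2) by linarith
    then show "z div 2 < 2 ^ w" by linarith
    show "2 ^ (t - Suc 0) + z div 2 < 2 ^ w" using iw by (simp add: node_idx_def)
    then show "(2::nat) ^ (t - Suc 0) < 2 ^ w" by linarith
  qed
  show "exp_val M node_addr r = node_idx t z"
    using w assms(1-4) T_le_w by (simp add: node_addr_def node_idx_def word_simps words
      push_bit_eq_mult drop_bit_eq_div)
qed

lemma wp_parity_load:
  assumes "r 1 = z" "z < 2 ^ w" "r 7 = i" "i < 2 * n" "i < 2 ^ w" "b < 10"
    and "wp M (block cs) Q \<lparr>regs = r(k := A (b + z mod 2) i), arrs = A, outp = os\<rparr>"
  shows "wp M (block (parity_load k b # cs)) Q \<lparr>regs = r, arrs = A, outp = os\<rparr>"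
proof -
  have "z mod 2 < 2 ^ w" using assms(2) by (rule le_less_trans[OF mod_less_eq_dividend])
  moreover have "z mod 2 = 0 \<or> z mod 2 = 1" by auto
  ultimately show ?thesis
    using assms w by (auto simp: parity_load_def word_simps and_one_eq)
qed

definition structure_ok :: "(nat \<Rightarrow> nat \<Rightarrow> nat) \<Rightarrow> bool" where
  "structure_ok A \<longleftrightarrow> A 0 = a \<and> nodes_ok A (\<lambda>_. {..<n}) \<and>
     (\<forall>p<n. A 6 p = next_pos (Suc p) (colour p) \<and> mask_ok (A 7 p) p \<and>
        A 9 p = next_pos p (Suc (p mod w))) \<and>
     (\<forall>i. A 8 i < 2 ^ w) \<and> (\<forall>j<w. field T e (A 8) j = next_pos 0 (Suc j)) \<and> A 10 0 = T"

lemma node_ok_structure: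
  assumes "structure_ok A" "1 \<le> t" "t \<le> T" "z < 2 ^ t"
  shows "node_ok A t z {..<n}"
  using assms unfolding structure_ok_def nodes_ok_def by simp

lemma word_query_correct:
  assumes A: "structure_ok A" and t: "1 \<le> t" "t \<le> T" and z: "z < 2 ^ t"
  shows "\<exists>v. is_word_rep w (h ` group w g L t z) v \<and> answers M word_query A t z 0 [v] (cost word_query)"
proof -
  define v where "v = A (2 + z mod 2) (node_idx t z)"
  have v: "v < 2 ^ w" "\<And>k. k < w \<Longrightarrow> bit v k \<longleftrightarrow> (\<exists>p\<in>{..<n}. prefix_of t p = z \<and> colour p = Suc k)"
    using node_ok_structure[OF A t z] unfolding node_ok_def v_def Let_def by auto
  have "bit v (y - 1) \<longleftrightarrow> y \<in> h ` group w g L t z" if "y \<in> {1..w}" for y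
  proof -
    have "bit v (y - 1) \<longleftrightarrow> (\<exists>p\<in>{..<n}. prefix_of t p = z \<and> colour p = y)"
      using v(2)[of "y - 1"] that by auto
    also have "\<dots> \<longleftrightarrow> y \<in> h ` group w g L t z"
      unfolding group_def image_a[symmetric] by auto
    finally show ?thesis .
  qed
  then have "is_word_rep w (h ` group w g L t z) v"
    using v(1) by (simp add: is_word_rep_def Words_def)
  moreover have v_eq: "take_bit w (A (2 + z mod 2) (node_idx t z)) = v"
    using v(1) by (simp only: v_def take_bit_nat_eq_self)
  have "wp M word_query (\<lambda>s. outp s = [v] \<and> arrs s = A) (query_state A t z 0)"
    unfolding word_query_def query_state_def
    apply (rule wp_block_Assign[where v = "node_idx t z"])
    subgoal by (rule node_addr_val) (use t z in auto)
    apply (rule wp_parity_load[where z = z and i = "node_idx t z"])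
    subgoal by simp
    subgoal using node_addr_val(3)[of "\<lambda>x. if x = 0 then t else z" t z] t z by simp
    subgoal by simp
    subgoal using node_addr_val(2)[of "\<lambda>x. if x = 0 then t else z" t z] t z by simp
    subgoal using node_addr_val(4)[of "\<lambda>x. if x = 0 then t else z" t z] t z by simp
    subgoal by simp
    apply (rule wp_block_Emit[where v = v])
    subgoal using v_eq by simp
    by simp
  then have "answers M word_query A t z 0 [v] (cost word_query)"
    using runs_wp unfolding runs_def answers_def by blast
  ultimately show ?thesis by blast
qed

text \<open>The case in which the saved answer is not before \<open>l\<close>: it is then the answer
  for \<open>l\<close> as well.\<close>

lemma next_pos_from:
  assumes "b \<le> l" "l \<le> q" "q < n" "colour q = y" "l \<le> next_pos b y"
  shows "next_pos l y = next_pos b y"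
  using assms next_pos_props[of b q y] by (intro next_pos_eqI) auto

text \<open>After the shift, bit \<open>j\<close> describes position \<open>l - 1 - j\<close>. The
  bit of the saved position itself is among these, so the word is nonzero and \<open>i\<close> leads
  to the last occurrence before \<open>l\<close>; the link of that occurrence skips to the first one
  from \<open>l\<close> on.\<close>

lemma next_pos_mask:
  assumes b: "b \<le> l" "l - b < w" and q: "l \<le> q" "q < n" "colour q = y"
    and v: "mask_ok v (next_pos b y)" and less: "next_pos b y < l"
    and i: "i = unop_val w Ctz (drop_bit (w - (l - next_pos b y)) v)"
  shows "i < l - next_pos b y" "colour (l - 1 - i) = y" "next_pos (Suc (l - 1 - i)) y = next_pos l y"
proof -
  let ?p = "next_pos b y" and ?u = "drop_bit (w - (l - next_pos b y)) v"
  have p: "b \<le> ?p" "colour ?p = y" using next_pos_props[of b q y] b q by auto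
  have bit_u: "bit ?u j \<longleftrightarrow> colour (l - 1 - j) = y" if "j < l - ?p" for j
  proof -
    have "bit ?u j \<longleftrightarrow> bit v (w - (l - ?p) + j)" by (simp add: bit_drop_bit_eq)
    moreover have "w - (l - ?p) + j < w" using that b p by simp
    moreover have "?p + (w - 1 - (w - (l - ?p) + j)) = l - 1 - j" using that b p less by simp
    moreover have "l - 1 - j < n" using q less by simp
    ultimately show ?thesis using v p(2) by (simp add: mask_ok_def)
  qed
  have last: "bit ?u (l - ?p - 1)" using bit_u[of "l - ?p - 1"] less p(2) by simp
  have "?u \<noteq> 0"
  proof
    assume "?u = 0"
    then show False using last by simp
  qed
  then have i': "i = (LEAST k. bit ?u k)" using i by simp
  have "bit ?u i" unfolding i' using last by (rule LeastI)
  have "i \<le> l - ?p - 1" unfolding i' using last by (rule Least_le)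
  then show il: "i < l - ?p" using less by simp
  then show "colour (l - 1 - i) = y" using bit_u \<open>bit ?u i\<close> by blast
  have none: "colour r \<noteq> y" if r: "Suc (l - 1 - i) \<le> r" "r < l" for r
  proof -
    have "l - 1 - r < i" using r il by linarith
    then have "\<not> bit ?u (l - 1 - r)" unfolding i' by (rule not_less_Least)
    moreover have "l - 1 - r < l - ?p" using \<open>l - 1 - r < i\<close> il by simp
    moreover have "l - 1 - (l - 1 - r) = r" using r by simp
    ultimately show ?thesis using bit_u[of "l - 1 - r"] by simp
  qed
  show "next_pos (Suc (l - 1 - i)) y = next_pos l y"
  proof (rule next_pos_eqI)
    note props = next_pos_props[OF q]
    show "Suc (l - 1 - i) \<le> next_pos l y" using props(1) less by simp
    show "next_pos l y < n" by (rule next_pos_less)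
    show "colour (next_pos l y) = y" by (rule props)
    show "colour r \<noteq> y" if "Suc (l - 1 - i) \<le> r" "r < next_pos l y" for r
      using none[of r] props(4)[of r] that by (cases "r < l") auto
  qed
qed

lemma locate_correct:
  assumes A: "structure_ok A" and t: "1 \<le> t" "t \<le> T" and z: "z < 2 ^ t" and y: "1 \<le> y" "y \<le> w"
    and l: "A (4 + z mod 2) (node_idx t z) = l"
    and q: "l \<le> q" "q < n" "colour q = y"
    and r: "r 0 = t" "r 1 = z" "r 2 = y" "r 7 = node_idx t z"
  shows "wp M locate (\<lambda>s. regs s 0 = t \<and> regs s 3 = z \<and> regs s 10 = next_pos l y \<and> arrs s = A \<and>
    outp s = os) \<lparr>regs = r, arrs = A, outp = os\<rparr>"
proof -
  define y0 where "y0 = y - 1"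
  have y0: "y0 < w" "Suc y0 = y" using y by (auto simp: y0_def)
  define b where "b = (if l < y0 then 0 else l - (l - y0) mod w)"
  define p where "p = next_pos b y"
  note A' = A[unfolded structure_ok_def]
  have "(l - y0) mod w < w" using w by simp
  then have "l - (l - (l - y0) mod w) < w" by linarith
  \<comment> \<open>For \<open>b = 0\<close> the distance is \<open>l < y0 < w\<close>, so the mask
    also reaches far enough when the search starts from the packed table.\<close>
  then have b: "b \<le> l" "l - b < w" using y0 by (auto simp: b_def)
  have b_mod: "b mod w = y0" if "\<not> l < y0"
  proof -
    have "b = y0 + (l - y0) div w * w"
    proof -
      have "l - y0 = (l - y0) div w * w + (l - y0) mod w" by simp
      moreover have "b = l - (l - y0) mod w" using that by (simp add: b_def)
      ultimately show ?thesis using that by linarith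
    qed
    then show ?thesis using y0 by simp
  qed
  have ln: "l < n" using q by simp
  have pn: "p < n" unfolding p_def by (rule next_pos_less)
  have mask: "mask_ok (A 7 p) p" using A' pn by blast
  have tw: "t \<le> w" using t T_le_w by simp
  have zw: "z < 2 ^ w" "node_idx t z < 2 * n" "node_idx t z < 2 ^ w"
    using node_addr_val[of r t z] r t z by auto
  have words: "t < 2 ^ w" "z < 2 ^ w" "y < 2 ^ w" "y0 < 2 ^ w" "w < 2 ^ w" "l < 2 ^ w" "p < 2 ^ w"
    "T < 2 ^ w" "e < 2 ^ w" "b < 2 ^ w" "A 7 p < 2 ^ w"
    using le_w_word tw zw y y0 less_n_word[OF ln] less_n_word[OF pn] T_le_w b mask
    by (auto simp: e_def mask_ok_def)
  have mod_word: "(l - y0) mod w < 2 ^ w" using w words(5) by (meson less_trans mod_less_divisor less_le_trans zero_less_one)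
  have first: "field T e (A 8) y0 = next_pos 0 y" using A' y0 by auto
  have saved: "A 9 b = p" if "\<not> l < y0"
    using A' b ln b_mod[OF that] y0 by (simp add: p_def)
  show ?thesis
    unfolding locate_def
    apply (rule wp_parity_load[where z = z and i = "node_idx t z"])
    subgoal using r by simp
    subgoal by (rule zw)
    subgoal using r by simp
    subgoal by (rule zw)
    subgoal by (rule zw)
    subgoal by simp
    apply (rule wp_block_Assign[where v = z])
    subgoal using r by (simp add: word_simps words)
    apply (rule wp_block_Load[where v = 0 and u = T])
    subgoal by simp
    subgoal by simp
    subgoal using n by simp
    subgoal using A' by simp
    apply (rule wp_block_Assign[where v = y0])
    subgoal using r y w by (simp add: word_simps words y0_def)
    apply (rule wp_block_Assign[where v = e])
    subgoal by (simp add: word_simps words flip: e_def)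
    apply (rule field_read_correct[where k = y0])
    subgoal by simp
    subgoal by (rule y0)
    subgoal by simp
    subgoal by simp
    subgoal using A' by simp
    apply (rule wp_block_mid[where P = "\<lambda>s. regs s 0 = t \<and> regs s 3 = z \<and> regs s 4 = l \<and>
      regs s 10 = p \<and> arrs s = A \<and> outp s = os"])
    subgoal
      apply (rule wp_Cond[where v = "of_bool (l < y0)"])
      subgoal using l w by (simp add: word_simps words)
      subgoal using r l first by (simp add: p_def b_def)
      subgoal premises v
      proof -
        have "take_bit w (l - y0) = l - y0" using words(6) by (simp add: take_bit_nat_eq_self)
        moreover have "(l - y0) mod w \<le> l"
          by (meson mod_less_eq_dividend diff_le_self order_trans)
        moreover have "l - (l - y0) mod w < 2 * n" using ln by linarith
        ultimately show ?thesis
          using v r l saved b ln mod_word by (simp add: word_simps words b_def)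
      qed
      done
    subgoal premises s' for s'
      apply (rule wp_start)
      apply (rule wp_block_Cond[where v = "of_bool (p < l)"])
      subgoal using s' w by (simp add: word_simps words)
      subgoal premises v
      proof -
        define i where "i = unop_val w Ctz (drop_bit (w - (l - p)) (A 7 p))"
        have pl: "p < l" using v by (simp split: if_splits)
        note mask_pos = next_pos_mask[OF b q mask[unfolded p_def] pl[unfolded p_def]
            i_def[unfolded p_def], folded p_def]
        have iw: "i < 2 ^ w" using mask_pos(1) words(6) by linarith
        have dw: "drop_bit (w - (l - p)) (A 7 p) < 2 ^ w"
          using words(11) by (metis div_le_dividend drop_bit_eq_div le_less_trans)
        have lp: "l - p \<le> w" "l - p < 2 ^ w" "w - (l - p) < 2 ^ w" "l - 1 < 2 ^ w" "l - Suc 0 < 2 ^ w"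
          "l - Suc i < 2 ^ w"
          using b(2) words next_pos_props(1)[of b q y] q b(1) le_w_word[of "w - (l - p)"]
          unfolding p_def by auto
        have ctz_val: "exp_val M (Unop Ctz (Binop Shr (Reg 11) (Binop Sub Width
            (Binop Sub (Reg 4) (Reg 10))))) r' = i"
          if r': "r' 11 = A 7 p" "r' 4 = l" "r' 10 = p" for r'
        proof -
          note eqs = take_bit_sub(1)[OF less_imp_le[OF pl] words(6)] take_bit_sub(1)[OF lp(1) words(5)]
            words(5,6,7,11)[THEN take_bit_nat_eq_self] dw[THEN take_bit_nat_eq_self]
            iw[THEN take_bit_nat_eq_self]
          show ?thesis
            by (simp only: exp_val.simps binop_val.simps r' M_simps eqs i_def[symmetric])
        qed
        have last_val: "exp_val M (Binop Sub (Binop Sub (Reg 4) (Lit 1)) (Reg 11)) r' = l - 1 - i"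
          if r': "r' 4 = l" "r' 11 = i" for r'
        proof -
          have "take_bit w (1 :: nat) = 1" "1 \<le> l" "i \<le> l - 1" using w pl mask_pos(1) by auto
          note eqs = this(1) take_bit_sub(1)[OF this(2) words(6)] take_bit_sub(1)[OF this(3) lp(4)]
            words(6)[THEN take_bit_nat_eq_self] iw[THEN take_bit_nat_eq_self]
          show ?thesis by (simp only: exp_val.simps binop_val.simps r' M_simps eqs)
        qed
        have last: "l - 1 - i < n" using ln by simp
        show ?thesis
          apply (rule wp_block_block, simp only: append.simps)
          apply (rule wp_block_Load[where v = p and u = "A 7 p"])
          subgoal using s' by (simp add: word_simps words)
          subgoal by simp
          subgoal using pn by simp
          subgoal using s' by simp
          apply (rule wp_block_Assign[where v = i])
          subgoal by (rule ctz_val) (use s' in simp_all)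
          apply (rule wp_block_Load[where v = "l - 1 - i" and u = "next_pos l y"])
          subgoal by (rule last_val) (use s' in simp_all)
          subgoal by simp
          subgoal using last by simp
          subgoal using s' A' last mask_pos by simp
          apply (rule wp_block_Nil)
          using s' by simp
      qed
      subgoal premises v
        apply (rule wp_block_Skip)
        apply (rule wp_block_Nil)
        using s' v next_pos_from[OF b(1) q] by (simp add: p_def)
      done
    done
qed

end

text \<open>Each listed element takes 7 steps, the body of the walk and its test; 3 more are the
  branch, the initial flag and the failing test.\<close>

definition list_query_cost :: nat where
  "list_query_cost = cost list_query_init + cost locate + 10"

section \<open>Listing a preimage along the links\<close>

context sorted_input
begin

definition members :: "nat \<Rightarrow> nat \<Rightarrow> nat \<Rightarrow> nat set" where
  "members t z y = {p. p < n \<and> prefix_of t p = z \<and> colour p = y}"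

text \<open>Prefixes are monotone in the position: once the next occurrence has left the group, no
  later one can lie in it.\<close>

lemma members_step:
  assumes p: "p \<in> members t z y" and q: "q = next_pos (Suc p) y"
  shows "q \<noteq> 0 \<Longrightarrow> prefix_of t q = z \<Longrightarrow> q \<in> members t z y \<and> p < q \<and>
      {r \<in> members t z y. r < q} = insert p {r \<in> members t z y. r < p}"
    and "q = 0 \<or> prefix_of t q \<noteq> z \<Longrightarrow> members t z y = insert p {r \<in> members t z y. r < p}"
proof -
  have first: "q \<le> r" if "r \<in> members t z y" "p < r" for r
    using next_pos_props(2)[of "Suc p" r y] that q by (auto simp: members_def)
  {
    assume q0: "q \<noteq> 0" "prefix_of t q = z"
    then obtain q' where "Suc p \<le> q'" "q' < n" "colour q' = y"
      using next_pos_neq_0 q by metis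
    then have "p < q" "colour q = y"
      using next_pos_props(1,3)[of "Suc p" q' y] q by (auto simp: Suc_le_eq)
    moreover have "q < n" using q next_pos_less by simp
    ultimately have "q \<in> members t z y" "p < q" using q0 by (auto simp: members_def)
    then show "q \<in> members t z y \<and> p < q \<and>
      {r \<in> members t z y. r < q} = insert p {r \<in> members t z y. r < p}"
      using p first by (fastforce simp: not_less)
  }
  assume q0: "q = 0 \<or> prefix_of t q \<noteq> z"
  have "\<not> p < r" if r: "r \<in> members t z y" for r
  proof
    assume "p < r"
    then have rn: "Suc p \<le> r" "r < n" "colour r = y" using r by (auto simp: members_def)
    note props = next_pos_props[OF this, folded q]
    have "prefix_of t p \<le> prefix_of t q" "prefix_of t q \<le> prefix_of t r"
      using props rn prefix_of_mono by auto
    then have "prefix_of t q = z" using p r by (simp add: members_def)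
    then show False using q0 props(1) by simp
  qed
  then show "members t z y = insert p {r \<in> members t z y. r < p}"
    using p by (auto simp: not_less order_le_less)
qed

lemma finite_members: "finite (members t z y)"
  by (rule finite_subset[of _ "{..<n}"]) (auto simp: members_def)

lemma walk_correct:
  assumes A: "structure_ok A" and t: "1 \<le> t" "t \<le> T" and z: "z < 2 ^ t"
    and s: "regs s 0 = t" "regs s 3 = z" "regs s 10 = p" "regs s 5 = 1" "arrs s = A" "outp s = ys"
    and p: "p \<in> members t z y"
    and ys: "set ys = a ` {q \<in> members t z y. q < p}" "sorted_wrt (<) (map g ys)"
    and m: "m = card {q \<in> members t z y. p \<le> q}"
  shows "runs M (While (Reg 5) walk_body) s (m * 7 + 1) (\<lambda>s'. arrs s' = A \<and>
    set (outp s') = a ` members t z y \<and> sorted_wrt (<) (map g (outp s')))"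
  using s p ys m
proof (induction m arbitrary: s p ys)
  case 0
  moreover have "finite {q \<in> members t z y. p \<le> q}" using finite_members[of t z y] by simp
  ultimately have False by auto
  then show ?case ..
next
  case (Suc m)
  let ?Q = "\<lambda>s'. arrs s' = A \<and> set (outp s') = a ` members t z y \<and> sorted_wrt (<) (map g (outp s'))"
  define q where "q = next_pos (Suc p) y"
  define more where "more \<longleftrightarrow> q \<noteq> 0 \<and> prefix_of t q = z"
  note A' = A[unfolded structure_ok_def]
  have p: "p < n" "colour p = y" "prefix_of t p = z" using Suc.prems by (auto simp: members_def)
  have qn: "q < n" unfolding q_def by (rule next_pos_less)
  have tw: "t \<le> w" using t T_le_w by simp
  have "z < 2 ^ w" using z tw by (meson less_le_trans one_le_numeral power_increasing)
  then have words: "t < 2 ^ w" "z < 2 ^ w" "p < 2 ^ w" "q < 2 ^ w" "w < 2 ^ w"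
    using le_w_word tw less_n_word p qn by auto
  have body: "wp M walk_body (\<lambda>s'. regs s' 0 = t \<and> regs s' 3 = z \<and> regs s' 10 = q \<and>
      regs s' 5 = of_bool more \<and> arrs s' = A \<and> outp s' = ys @ [a p]) s"
    unfolding walk_body_def
    apply (rule wp_start)
    apply (rule wp_block_Load[where v = p and u = "a p"])
    subgoal using Suc.prems by (simp add: word_simps words)
    subgoal by simp
    subgoal using p by simp
    subgoal using Suc.prems A' by simp
    apply (rule wp_block_Emit[where v = "a p"])
    subgoal using word_a[OF p(1)] by (simp add: word_simps)
    apply (rule wp_block_Load[where v = p and u = q])
    subgoal using Suc.prems by (simp add: word_simps words)
    subgoal by simp
    subgoal using p by simp
    subgoal using Suc.prems A' p by (simp add: q_def)
    \<comment> \<open>For a missing successor this reads cell 0; the conjunct \<open>0 < q\<close>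
      in the flag discards the result.\<close>
    apply (rule wp_block_Load[where v = q and u = "a q"])
    subgoal by (simp add: word_simps words)
    subgoal by simp
    subgoal using qn by simp
    subgoal using Suc.prems A' by simp
    apply (rule wp_block_Assign[where v = "of_bool more"])
    subgoal premises _
    proof -
      have "drop_bit (w - t) (g (a q)) < 2 ^ w"
        using word_g_a[OF qn] by (metis div_le_dividend drop_bit_eq_div le_less_trans)
      then show ?thesis
        using Suc.prems tw word_a[OF qn] w
        by (auto simp: word_simps words more_def top_bits_def)
    qed
    apply (rule wp_block_Nil)
    using Suc.prems by simp
  have cost: "cost walk_body = 6" by (simp add: walk_body_def)
  have set_ys: "set (ys @ [a p]) = a ` insert p {r \<in> members t z y. r < p}"
    using Suc.prems by auto
  have sorted_ys: "sorted_wrt (<) (map g (ys @ [a p]))"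
    using Suc.prems g_a_less p(1) by (auto simp: sorted_wrt_append)
  have "runs M walk_body s 6 (\<lambda>s'. runs M (While (Reg 5) walk_body) s' (m * 7 + 1) ?Q)"
  proof (rule runs_mono[OF runs_wp[OF body]])
    fix s' :: state
    assume s': "regs s' 0 = t \<and> regs s' 3 = z \<and> regs s' 10 = q \<and>
      regs s' 5 = of_bool more \<and> arrs s' = A \<and> outp s' = ys @ [a p]"
    show "runs M (While (Reg 5) walk_body) s' (m * 7 + 1) ?Q"
    proof (cases more)
      case True
      then have q: "q \<in> members t z y" "p < q"
        "{r \<in> members t z y. r < q} = insert p {r \<in> members t z y. r < p}"
        using members_step(1)[OF Suc.prems(7) q_def] by (auto simp: more_def)
      have split: "{r \<in> members t z y. p \<le> r} = insert p {r \<in> members t z y. q \<le> r}"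
      proof -
        have "r = p" if "r \<in> members t z y" "p \<le> r" "r < q" for r
        proof (rule ccontr)
          assume "r \<noteq> p"
          then have "r \<in> insert p {r \<in> members t z y. r < p}" using q(3) that by blast
          then show False using \<open>r \<noteq> p\<close> that by simp
        qed
        then show ?thesis using q(2) Suc.prems(7) by (auto simp: not_less[symmetric])
      qed
      have "finite {r \<in> members t z y. q \<le> r}" using finite_members by simp
      then have "m = card {r \<in> members t z y. q \<le> r}"
        using Suc.prems(10) q(2) unfolding split by simp
      then show ?thesis
        by (intro Suc.IH[of s' q "ys @ [a p]"]) (use s' True q set_ys sorted_ys in simp_all)
    next
      case False
      then have "members t z y = insert p {r \<in> members t z y. r < p}"
        using members_step(2)[OF Suc.prems(7) q_def] by (auto simp: more_def)
      then have "set (ys @ [a p]) = a ` members t z y" using set_ys by simp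
      then show ?thesis
        using s' False sorted_ys by (intro runs_mono[OF runs_While_0]) auto
    qed
  qed (simp add: cost)
  then have "runs M (While (Reg 5) walk_body) s (Suc (6 + (m * 7 + 1))) ?Q"
    by (intro runs_While_Suc) (use Suc.prems w in auto)
  then show ?case by (auto elim!: runs_mono)
qed

lemma preimage_eq:
  "hash_preimage h y (group w g L t z) = a ` members t z y"
  unfolding hash_preimage_def group_def image_a[symmetric] members_def by auto

lemma card_preimage: "card (hash_preimage h y (group w g L t z)) = card (members t z y)"
proof -
  have "inj_on a {..<n}" using image_a card_L by (intro eq_card_imp_inj_on) auto
  then have "inj_on a (members t z y)" by (rule inj_on_subset) (auto simp: members_def)
  then show ?thesis unfolding preimage_eq by (rule card_image)
qed

lemma list_query_correct:
  assumes A: "structure_ok A" and t: "1 \<le> t" "t \<le> T" and z: "z < 2 ^ t" and y: "y \<in> {1..w}"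
  shows "\<exists>ys. set ys = hash_preimage h y (group w g L t z) \<and> sorted_wrt (<) (map g ys) \<and>
    answers M list_query A t z y ys
      (list_query_cost * (1 + card (hash_preimage h y (group w g L t z))))"
proof -
  define m where "m = card (members t z y)"
  define i where "i = node_idx t z"
  define v where "v = A (2 + z mod 2) i"
  define l where "l = A (4 + z mod 2) i"
  let ?r = "(\<lambda>_. 0)(0 := t, 1 := z, 2 := y)"
  let ?Q = "\<lambda>s'. arrs s' = A \<and> set (outp s') = a ` members t z y \<and> sorted_wrt (<) (map g (outp s'))"
  have ok: "node_ok A t z {..<n}" by (rule node_ok_structure[OF A t z])
  then have v: "v < 2 ^ w" "bit v (y - 1) \<longleftrightarrow> members t z y \<noteq> {}"
    using y unfolding node_ok_def v_def i_def Let_def by (auto simp: members_def)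
  have addr: "exp_val M node_addr ?r = i" "i < 2 * n" "z < 2 ^ w" "i < 2 ^ w"
    using node_addr_val[of ?r t z] t z by (simp_all add: i_def)
  have words: "y < 2 ^ w" "w < 2 ^ w" using y le_w_word by auto
  have init: "wp M list_query_init (\<lambda>s. s = \<lparr>regs = ?r(7 := i, 9 := v), arrs = A, outp = []\<rparr>)
      (query_state A t z y)"
    unfolding list_query_init_def query_state_def
    apply (rule wp_block_Assign[where v = i])
    subgoal by (rule addr)
    apply (rule wp_parity_load[where z = z and i = i])
    subgoal by simp
    subgoal by (rule addr)
    subgoal by simp
    subgoal by (rule addr)
    subgoal by (rule addr)
    subgoal by simp
    apply (rule wp_block_Nil)
    by (simp add: v_def)
  have test: "exp_val M (Binop And (Binop Shr (Reg 9) (Binop Sub (Reg 2) (Lit 1))) (Lit 1))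
      (?r(7 := i, 9 := v)) \<noteq> 0 \<longleftrightarrow> members t z y \<noteq> {}"
  proof -
    have "drop_bit (y - 1) v < 2 ^ w"
      using v(1) by (metis div_le_dividend drop_bit_eq_div le_less_trans)
    moreover have "take_bit w (of_bool (bit v (y - 1))) = (of_bool (bit v (y - 1)) :: nat)"
      by (rule take_bit_of_bool_word[OF w])
    ultimately show ?thesis
      using w y v
      by (simp add: word_simps words and_one_eq mod_2_eq_odd bit_iff_odd_drop_bit)
  qed
  have main: "runs M (Seq locate (Seq (Assign 5 (Lit 1)) (While (Reg 5) walk_body)))
      \<lparr>regs = ?r(7 := i, 9 := v), arrs = A, outp = []\<rparr> (cost locate + (1 + (m * 7 + 1))) ?Q"
    if ne: "members t z y \<noteq> {}"
  proof -
    obtain q where "q \<in> members t z y" using ne by blast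
    then have q: "q < n" "prefix_of t q = z" "colour q = y" by (auto simp: members_def)
    then have l: "l \<le> q" "l < n" "prefix_of t l = z"
      using ok unfolding node_ok_def l_def i_def Let_def by auto
    have lmin: "l \<le> p" if "p \<in> members t z y" for p
      using that ok unfolding node_ok_def l_def i_def Let_def by (auto simp: members_def)
    define p where "p = next_pos l y"
    note props = next_pos_props[OF l(1) q(1,3), folded p_def]
    have pn: "p < n" unfolding p_def by (rule next_pos_less)
    \<comment> \<open>The first occurrence found lies between \<open>l\<close> and a member
      \<open>q\<close>, both with prefix \<open>z\<close>.\<close>
    have "prefix_of t l \<le> prefix_of t p" "prefix_of t p \<le> prefix_of t q"
      using props q(1) pn prefix_of_mono by auto
    then have p: "p \<in> members t z y" using props pn q l by (simp add: members_def)
    have pmin: "p \<le> r" if "r \<in> members t z y" for r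
      using next_pos_props(2)[OF lmin[OF that], of y] that by (auto simp: members_def p_def)
    have "{r \<in> members t z y. r < p} = {}" "{r \<in> members t z y. p \<le> r} = members t z y"
      using pmin by (auto simp: not_less)
    then have walk: "runs M (While (Reg 5) walk_body) s (m * 7 + 1) ?Q"
      if "regs s 0 = t" "regs s 3 = z" "regs s 10 = p" "regs s 5 = 1" "arrs s = A" "outp s = []" for s
      by (intro walk_correct[OF A t z that p]) (simp_all add: m_def)
    have loc: "wp M locate (\<lambda>s. regs s 0 = t \<and> regs s 3 = z \<and> regs s 10 = p \<and> arrs s = A \<and>
        outp s = []) \<lparr>regs = ?r(7 := i, 9 := v), arrs = A, outp = []\<rparr>"
      unfolding p_def
      by (rule locate_correct[OF A t z _ _ _ l(1) q(1,3)]) (use y in \<open>simp_all add: i_def l_def\<close>)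
    show ?thesis
    proof (rule runs_Seq, rule runs_mono[OF runs_wp[OF loc]])
      fix s :: state
      assume s: "regs s 0 = t \<and> regs s 3 = z \<and> regs s 10 = p \<and> arrs s = A \<and> outp s = []"
      have "wp M (Assign 5 (Lit 1)) (\<lambda>s'. s' = s\<lparr>regs := (regs s)(5 := 1)\<rparr>) s" using w by simp
      then have "runs M (Assign 5 (Lit 1)) s 1 (\<lambda>s'. s' = s\<lparr>regs := (regs s)(5 := 1)\<rparr>)"
        using runs_wp by fastforce
      then show "runs M (Seq (Assign 5 (Lit 1)) (While (Reg 5) walk_body)) s (1 + (m * 7 + 1)) ?Q"
        by (intro runs_Seq) (erule runs_mono, simp, use walk s in simp)
    qed simp
  qed
  have "runs M list_query (query_state A t z y)
      (cost list_query_init + Suc (cost locate + (1 + (m * 7 + 1)))) ?Q"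
    unfolding list_query_def
  proof (rule runs_Seq, rule runs_mono[OF runs_wp[OF init]])
    fix s :: state
    assume s: "s = \<lparr>regs = ?r(7 := i, 9 := v), arrs = A, outp = []\<rparr>"
    show "runs M (Cond (Binop And (Binop Shr (Reg 9) (Binop Sub (Reg 2) (Lit 1))) (Lit 1))
       (Seq locate (Seq (Assign 5 (Lit 1)) (While (Reg 5) walk_body))) Skip) s
       (Suc (cost locate + (1 + (m * 7 + 1)))) ?Q"
    proof (rule runs_Cond)
      assume "exp_val M (Binop And (Binop Shr (Reg 9) (Binop Sub (Reg 2) (Lit 1))) (Lit 1)) (regs s) \<noteq> 0"
      then have "members t z y \<noteq> {}" unfolding s using test by simp
      then show "runs M (Seq locate (Seq (Assign 5 (Lit 1)) (While (Reg 5) walk_body))) s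
          (cost locate + (1 + (m * 7 + 1))) ?Q"
        unfolding s by (rule main)
    next
      assume "exp_val M (Binop And (Binop Shr (Reg 9) (Binop Sub (Reg 2) (Lit 1))) (Lit 1)) (regs s) = 0"
      then have "members t z y = {}" unfolding s using test by simp
      then have "wp M Skip ?Q s" unfolding s by simp
      then show "runs M Skip s (cost locate + (1 + (m * 7 + 1))) ?Q"
        by (rule runs_mono[OF runs_wp]) auto
    qed
  qed simp
  moreover have "cost list_query_init + Suc (cost locate + (1 + (m * 7 + 1))) \<le>
      list_query_cost * (1 + m)"
    by (simp add: list_query_cost_def algebra_simps)
  ultimately have "runs M list_query (query_state A t z y) (list_query_cost * (1 + m)) ?Q"
    by (rule runs_mono)
  then obtain k s where s: "exec M list_query (query_state A t z y) k s"
    "k \<le> list_query_cost * (1 + m)" "?Q s"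
    unfolding runs_def by blast
  have "answers M list_query A t z y (outp s) (list_query_cost * (1 + m))"
    unfolding answers_def by (rule exI[of _ k], rule exI[of _ s]) (use s in simp)
  then show ?thesis
    by (intro exI[of _ "outp s"])
       (use s(3) card_preimage[of y t z] in \<open>simp add: preimage_eq m_def\<close>)
qed

end

section \<open>Assembly of the pre-processing and its running time\<close>

definition preprocess :: com where
  "preprocess = Cond (Reg 0)
     (Seq (levels sort_level)
       (Seq (levels (sweep node_body)) (Seq (sweep link_body) (Store 10 (Lit 0) (Reg 1)))))
     Skip"

definition preprocess_time :: "nat \<Rightarrow> nat" where
  "preprocess_time n = (let T = nat \<lceil>log 2 (real n)\<rceil> in
     Suc (T * (sort_level_time n + 2) + 2 + (T * (n * (cost node_body + 3) + 3 + 2) + 2 +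
       (n * (cost link_body + 3) + 3 + 1))))"

context sorted_input
begin

lemma nodes_ok_cong:
  assumes "\<And>i. 2 \<le> i \<Longrightarrow> i \<le> 5 \<Longrightarrow> A' i = A i" "nodes_ok A S"
  shows "nodes_ok A' S"
proof -
  have "A' (2 + z mod 2) = A (2 + z mod 2)" "A' (4 + z mod 2) = A (4 + z mod 2)" for z
  proof -
    have "z mod 2 < 2" by simp
    then show "A' (2 + z mod 2) = A (2 + z mod 2)" "A' (4 + z mod 2) = A (4 + z mod 2)"
      by (intro assms(1); linarith)+
  qed
  then show ?thesis using assms(2) unfolding nodes_ok_def node_ok_def by simp
qed

text \<open>The closing store saves \<open>T\<close> in memory, because a query starts without the
  registers of the pre-processing.\<close>

lemma link_correct:
  assumes s: "arrs s 0 = a" "\<And>i. i \<ge> 6 \<Longrightarrow> arrs s i = (\<lambda>_. 0)" "nodes_ok (arrs s) (\<lambda>_. {..<n})"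
    "regs s 0 = n - 1" "regs s 1 = T"
  shows "runs M (Seq (sweep link_body) (Store 10 (Lit 0) (Reg 1))) s
    (n * (cost link_body + 3) + 3 + 1) (\<lambda>s'. structure_ok (arrs s'))"
proof (rule runs_Seq)
  have T: "T < 2 ^ w" using T_le_w by (rule le_w_word)
  have "runs M (sweep link_body) s ((n - 1 + 1) * (cost link_body + 3) + 3)
      (\<lambda>s'. link_inv (arrs s) (Suc (n - 1)) s' \<and> regs s' 0 = n - 1)"
  proof (rule runs_sweep)
    \<comment> \<open>The empty suffix has no occurrences, which is what the zeroed packed table
      says.\<close>
    have "next_pos n y = 0" for y by (auto simp: next_pos_def)
    then show "link_inv (arrs s) 0 s"
      using s by (simp add: link_inv_def field_def)
    show "runs M link_body s' (cost link_body)
        (\<lambda>s''. link_inv (arrs s) (Suc k) s'' \<and> regs s'' 0 = n - 1 \<and> regs s'' 2 = k)"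
      if "k \<le> n - 1" "link_inv (arrs s) k s'" "regs s' 0 = n - 1" "regs s' 2 = k" for k s'
      by (rule runs_wp, rule link_body_correct) (use that in auto)
  qed (use w N s in \<open>auto simp: link_inv_def\<close>)
  then show "runs M (sweep link_body) s (n * (cost link_body + 3) + 3)
      (\<lambda>s'. runs M (Store 10 (Lit 0) (Reg 1)) s' 1 (\<lambda>s'. structure_ok (arrs s')))"
  proof (rule runs_mono)
    fix s' assume "link_inv (arrs s) (Suc (n - 1)) s' \<and> regs s' 0 = n - 1"
    then have s': "link_inv (arrs s) n s'" using N by simp
    define A where "A = (arrs s')(10 := (arrs s' 10)(0 := T))"
    have "nodes_ok A (\<lambda>_. {..<n})"
      by (rule nodes_ok_cong[OF _ s(3)]) (use s' in \<open>auto simp: A_def link_inv_def\<close>)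
    then have "structure_ok A"
      using s' unfolding link_inv_def structure_ok_def by (simp add: A_def)
    then have "wp M (Store 10 (Lit 0) (Reg 1)) (\<lambda>s'. structure_ok (arrs s')) s'"
      using s' n T by (simp add: link_inv_def word_simps A_def)
    then show "runs M (Store 10 (Lit 0) (Reg 1)) s' 1 (\<lambda>s'. structure_ok (arrs s'))"
      using runs_wp by fastforce
  qed (use n in simp)
qed

end

context preprocessing
begin

lemma preprocess_correct:
  assumes s: "arrs s 0 ` {..<n} = L" "\<And>i. i \<ge> 2 \<Longrightarrow> arrs s i = (\<lambda>_. 0)" "regs s 0 = n - 1"
  shows "runs M preprocess s (preprocess_time n)
    (\<lambda>s'. \<exists>a. sorted_input w g h L n a \<and> sorted_input.structure_ok w g h n a (arrs s'))"
  unfolding preprocess_def preprocess_time_def Let_def T_def[symmetric]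
proof (rule runs_Cond)
  show "runs M (Seq (levels sort_level)
       (Seq (levels (sweep node_body)) (Seq (sweep link_body) (Store 10 (Lit 0) (Reg 1))))) s
     (T * (sort_level_time n + 2) + 2 + (T * (n * (cost node_body + 3) + 3 + 2) + 2 +
       (n * (cost link_body + 3) + 3 + 1)))
     (\<lambda>s'. \<exists>a. sorted_input w g h L n a \<and> sorted_input.structure_ok w g h n a (arrs s'))"
  proof (rule runs_Seq, rule runs_mono[OF sort_correct[OF s]])
    fix s1 :: state
    assume s1: "sorted_array (arrs s1 0) \<and> (\<forall>i\<ge>2. arrs s1 i = (\<lambda>_. 0)) \<and> regs s1 0 = n - 1"
    define a where "a = arrs s1 0"
    interpret sorted_input w g h L n a
      by unfold_locales (use s1 in \<open>simp add: a_def\<close>)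
    show "runs M (Seq (levels (sweep node_body)) (Seq (sweep link_body) (Store 10 (Lit 0) (Reg 1)))) s1
        (T * (n * (cost node_body + 3) + 3 + 2) + 2 + (n * (cost link_body + 3) + 3 + 1))
        (\<lambda>s'. \<exists>a. sorted_input w g h L n a \<and> sorted_input.structure_ok w g h n a (arrs s'))"
    proof (rule runs_Seq, rule runs_mono[OF nodes_correct])
      fix s2 :: state
      assume s2: "arrs s2 0 = a \<and> (\<forall>i\<ge>6. arrs s2 i = (\<lambda>_. 0)) \<and> nodes_ok (arrs s2) (\<lambda>_. {..<n}) \<and>
        regs s2 0 = n - 1 \<and> regs s2 1 = T"
      show "runs M (Seq (sweep link_body) (Store 10 (Lit 0) (Reg 1))) s2
        (n * (cost link_body + 3) + 3 + 1)
        (\<lambda>s'. \<exists>a. sorted_input w g h L n a \<and> sorted_input.structure_ok w g h n a (arrs s'))"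
        by (rule runs_mono[OF link_correct]) (use s2 sorted_input_axioms in auto)
    qed (use s1 a_def in auto)
  qed simp_all
  \<comment> \<open>Register 0 holds \<open>n - 1\<close>, which is positive here; the branch exists
    for \<open>n = 1\<close>.\<close>
  assume "exp_val M (Reg 0) (regs s) = 0"
  then have False using s n N(1) by (simp add: take_bit_nat_eq_self)
  then show "runs M Skip s (T * (sort_level_time n + 2) + 2 + (T * (n * (cost node_body + 3) + 3 + 2) + 2 +
       (n * (cost link_body + 3) + 3 + 1)))
     (\<lambda>s'. \<exists>a. sorted_input w g h L n a \<and> sorted_input.structure_ok w g h n a (arrs s'))" ..
qed

end

lemma answers_mono: "answers M q A t z y ys b \<Longrightarrow> b \<le> b' \<Longrightarrow> answers M q A t z y ys b'"
  unfolding answers_def by (blast intro: order_trans)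

definition query_cost :: nat where
  "query_cost = cost word_query + list_query_cost"

lemma (in sorted_input) multi_resolution:
  assumes A: "structure_ok A"
  shows "multi_resolution M word_query list_query query_cost L A"
  unfolding multi_resolution_def Let_def card_L T_def[symmetric] M_simps
proof (intro ballI conjI)
  fix t z :: nat assume t: "t \<in> {1..T}" and z: "z \<in> {..<2 ^ t}"
  then obtain v where "is_word_rep w (h ` group w g L t z) v"
    "answers M word_query A t z 0 [v] (cost word_query)"
    using word_query_correct[OF A, of t z] by auto
  then show "\<exists>v. is_word_rep w (h ` group w g L t z) v \<and> answers M word_query A t z 0 [v] query_cost"
    using answers_mono by (force simp: query_cost_def)
  fix y :: nat assume y: "y \<in> {1..w}"
  let ?B = "hash_preimage h y (group w g L t z)"
  obtain ys where ys: "set ys = ?B" "sorted_wrt (<) (map g ys)"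
    "answers M list_query A t z y ys (list_query_cost * (1 + card ?B))"
    using list_query_correct[OF A, of t z y] t z y by auto
  have "list_query_cost * (1 + card ?B) \<le> query_cost * (1 + card ?B)"
    unfolding query_cost_def by (rule mult_le_mono1) simp
  then show "\<exists>ys. set ys = ?B \<and> sorted_wrt (<) (map g ys) \<and>
      answers M list_query A t z y ys (query_cost * (1 + card ?B))"
    using ys answers_mono by blast
qed

lemma preprocess_time_bigo:
  "(\<lambda>n. real (preprocess_time n)) \<in> O(\<lambda>n. real n * log 2 (real n))"
proof -
  \<comment> \<open>The 40 covers \<open>9 + 3 + 13 + 9\<close>, the constants of the terms that are
    absorbed into \<open>n * T\<close>.\<close>
  define D where "D = cost merge_body + cost copy_body + cost node_body + cost link_body + 40"
  have "real (preprocess_time n) \<le> 2 * real D * (real n * log 2 (real n))" if n: "n \<ge> 2" for n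
  proof -
    define T where "T = nat \<lceil>log 2 (real n)\<rceil>"
    have log: "log 2 (real n) \<ge> 1" using n by simp
    \<comment> \<open>Rounding up adds less than 1, and \<open>log 2 n\<close> is at least
      1.\<close>
    then have T: "T \<ge> 1" "real T \<le> 2 * log 2 (real n)" unfolding T_def by linarith+
    have "preprocess_time n = n * T * (cost merge_body + cost copy_body + cost node_body + 9) +
        (n * (cost link_body + 3) + 13 * T + 9)"
      unfolding preprocess_time_def sort_level_time_def Let_def T_def[symmetric]
      by (simp add: algebra_simps)
    also have "n * (cost link_body + 3) + 13 * T + 9 \<le>
        n * T * (cost link_body + 3) + 13 * (n * T) + 9 * (n * T)"
    proof (intro add_mono)
      show "n * (cost link_body + 3) \<le> n * T * (cost link_body + 3)"
        using T(1) by (intro mult_le_mono1) simp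
      have "1 * 1 \<le> n * T" using n T(1) by (intro mult_le_mono) auto
      then show "9 \<le> 9 * (n * T)" by simp
      show "13 * T \<le> 13 * (n * T)" using n by simp
    qed
    also have "n * T * (cost merge_body + cost copy_body + cost node_body + 9) +
        (n * T * (cost link_body + 3) + 13 * (n * T) + 9 * (n * T)) \<le> D * (n * T)"
      by (simp add: D_def algebra_simps)
    finally have "preprocess_time n \<le> D * (n * T)" by simp
    then have "real (preprocess_time n) \<le> real (D * (n * T))" by (rule of_nat_mono)
    also have "\<dots> = real D * (real n * real T)" by simp
    also have "\<dots> \<le> real D * (real n * (2 * log 2 (real n)))"
      by (intro mult_left_mono T) auto
    finally show ?thesis by simp
  qed
  moreover have "0 \<le> real n * log 2 (real n)" if "n \<ge> 2" for n using that by simp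
  ultimately show ?thesis
    by (intro bigoI[where c = "2 * real D"] eventually_at_top_linorderI[of 2]) auto
qed

theorem theorem3p8:
  shows "\<exists>(prep :: com) (q1 :: com) (q2 :: com) (K :: nat) (C :: nat)
            (cells :: nat \<Rightarrow> nat) (time :: nat \<Rightarrow> nat).
    (\<lambda>n. real (time n)) \<in> O(\<lambda>n. real n * log 2 (real n)) \<and>
    (\<lambda>n. real (K * cells n)) \<in> O(\<lambda>n. real n) \<and>
    (\<forall>(w :: nat) (F :: (nat \<Rightarrow> nat) set) (g :: nat \<Rightarrow> nat) (h :: nat \<Rightarrow> nat)
        (L :: nat set) (xs :: nat list).
       w \<ge> 1 \<longrightarrow> g permutes Words w \<longrightarrow> universal_family w F \<longrightarrow> h \<in> F \<longrightarrow>
       L \<subseteq> Words w \<longrightarrow> L \<noteq> {} \<longrightarrow> distinct xs \<longrightarrow> set xs = L \<longrightarrow>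
       (let M = \<lparr>wlen = w, gfun = g, hfun = h, narrays = K, ncells = cells (card L)\<rparr> in
        \<exists>k s. exec M prep (input_state xs) k s \<and> k \<le> time (card L) \<and>
              multi_resolution M q1 q2 C L (arrs s)))"
proof (rule exI[of _ preprocess], rule exI[of _ word_query], rule exI[of _ list_query],
    rule exI[of _ 11], rule exI[of _ query_cost], rule exI[of _ "\<lambda>n. 2 * n"],
    rule exI[of _ preprocess_time], intro conjI allI impI)
  show "(\<lambda>n. real (preprocess_time n)) \<in> O(\<lambda>n. real n * log 2 (real n))"
    by (rule preprocess_time_bigo)
  show "(\<lambda>n. real (11 * (2 * n))) \<in> O(\<lambda>n. real n)"
    by (intro bigoI[where c = 22]) simp
  fix w :: nat and F :: "(nat \<Rightarrow> nat) set" and g h :: "nat \<Rightarrow> nat" and L :: "nat set" and xs :: "nat list"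
  assume w: "w \<ge> 1" and g: "g permutes Words w" and F: "universal_family w F" and h: "h \<in> F"
    and L: "L \<subseteq> Words w" "L \<noteq> {}" and xs: "distinct xs" "set xs = L"
  define n where "n = card L"
  let ?M = "\<lparr>wlen = w, gfun = g, hfun = h, narrays = 11, ncells = 2 * n\<rparr>"
  have length: "length xs = n" using distinct_card[OF xs(1)] xs(2) by (simp add: n_def)
  have "runs ?M preprocess (input_state xs) (preprocess_time n)
      (\<lambda>s. multi_resolution ?M word_query list_query query_cost L (arrs s))"
  proof (cases "n \<ge> 2")
    case True
    have "h \<in> Words w \<rightarrow> {1..w}" using F h by (auto simp: universal_family_def)
    then interpret preprocessing w g h L n
      by unfold_locales (use w g L True n_def in auto)
    have "(!) xs ` {..<n} = L" using xs(2) length by (auto simp: set_conv_nth)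
    then have "(\<lambda>i. if i < n then xs ! i else 0) ` {..<n} = L" by force
    then have "runs M preprocess (input_state xs) (preprocess_time n)
      (\<lambda>s'. \<exists>a. sorted_input w g h L n a \<and> sorted_input.structure_ok w g h n a (arrs s'))"
      by (intro preprocess_correct) (simp_all add: input_state_def length)
    then show ?thesis
      unfolding M_def[symmetric]
      by (rule runs_mono) (auto intro: sorted_input.multi_resolution)
  next
    case False
    moreover have "n \<noteq> 0" using L xs unfolding n_def by (metis List.finite_set card_0_eq)
    ultimately have n1: "n = 1" by simp
    \<comment> \<open>For one element the logarithm is 0, so there is no resolution and any memory
      qualifies.\<close>
    have "runs ?M preprocess (input_state xs) (Suc 1) (\<lambda>s. True)"
      unfolding preprocess_def
    proof (rule runs_Cond)
      show "runs ?M Skip (input_state xs) 1 (\<lambda>s. True)"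
        unfolding runs_def by (blast intro: exec.Skip)
    qed (simp add: input_state_def length n1)
    then show ?thesis
    proof (rule runs_mono)
      show "multi_resolution ?M word_query list_query query_cost L (arrs s)" for s
        using n1 by (simp add: multi_resolution_def flip: n_def)
    qed (simp add: preprocess_time_def Let_def n1)
  qed
  then show "let M = \<lparr>wlen = w, gfun = g, hfun = h, narrays = 11, ncells = 2 * card L\<rparr> in
      \<exists>k s. exec M preprocess (input_state xs) k s \<and> k \<le> preprocess_time (card L) \<and>
        multi_resolution M word_query list_query query_cost L (arrs s)"
    unfolding runs_def Let_def n_def by blast
qed

end
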